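(* Let $p$ be a prime and let $G$ be a finite group with integer-valued character table, having $k$ conjugacy classes. Let $\mu = (\mu_1, \dots, \mu_k)$ and $\nu = (\nu_1, \dots, \nu_k)$ be $k$-multipartitions of $N$, indexing conjugacy classes of $G \wr S_N$. If $\mu \sim_p \nu$, then $M^\lambda_{\mu} \equiv M^\lambda_{\nu} \pmod{p}$ for all $k$-multipartitions $\lambda$ of $N$.
   Context: A finite group has integer-valued character table if all its complex irreducible characters take only integer values. $G \wr S_N$ is the group of $N \times N$ permutation matrices with nonzero entries in $G$ (equivalently $G^N \rtimes S_N$). Fix enumerations $C_1, \dots, C_k$ of the conjugacy classes of $G$ and $V_1, \dots, V_k$ of the complex irreducible representations of $G$. A $k$-multipartition of $N$ is a tuple $\lambda = (\lambda_1, \dots, \lambda_k)$ of partitions with $\sum_{i=1}^k |\lambda_i| = N$. Conjugacy classes: the conjugacy classes of $G \wr S_N$ are indexed by $k$-multipartitions of $N$. The multipartition $\mu$ attached to $x \in G \wr S_N$ is formed as follows: for each cycle of length $\ell$ of the underlying permutation of $x$, if the product (in cyclic order) of the nonzero entries of $x$ in that cycle lies in the class $C_i$ (this class is well defined), then add a part $\ell$ to $\mu_i$. Permutation modules: for a $k$-multipartition $\lambda$ of $N$, put $a_i = |\lambda_i|$, let $S_{\lambda_i} \subseteq S_{a_i}$ be the Young subgroup of $\lambda_i$, and let $G_{\lambda_i} = G \wr S_{\lambda_i} = G^{a_i} \rtimes S_{\lambda_i}$. Then $$M^{\lambda} = \mathrm{Ind}_{G_{\lambda_1} \times \cdots \times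 G_{\lambda_k}}^{G \wr S_N} \left( \boxtimes_{i=1}^k V_i^{\otimes a_i} \right),$$ where $G^{a_i}$ acts factorwise on $V_i^{\otimes a_i}$ and $S_{\lambda_i}$ permutes the tensor factors. $M^\lambda_\mu$ denotes the value of the character of $M^\lambda$ on the conjugacy class indexed by $\mu$ (an integer under the hypothesis on $G$). The relation $\sim_p$ is the equivalence relation on $k$-multipartitions generated by: $\mu \sim_p \nu$ if there is $j$ such that $\mu_i = \nu_i$ for all $i \neq j$, and $\nu_j$ is formed from $\mu_j$ by replacing one part of size $mp$ in $\mu_j$ (for some $m \ge 1$) with $p$ parts of size $m$. *)

theory Defs
  imports
    "HOL-Algebra.Group_Action"
    "HOL-Combinatorics.Orbits"
    "HOL-Number_Theory.Cong"
    "HOL-Computational_Algebra.Primes"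
    "HOL-Library.Multiset"
    "Jordan_Normal_Form.VS_Connect"
begin

section \<open>Complex matrix representations\<close>

definition mat_trace :: "complex mat \<Rightarrow> complex"
  where "mat_trace A = (\<Sum>i<dim_row A. A $$ (i, i))"

definition representation :: "('g, 'b) monoid_scheme \<Rightarrow> nat \<Rightarrow> ('g \<Rightarrow> complex mat) \<Rightarrow> bool"
  where "representation G n \<rho> \<longleftrightarrow> \<rho> \<in> hom G (units_of (ring_mat TYPE(complex) n ()))"

definition irreducible_rep :: "('g, 'b) monoid_scheme \<Rightarrow> nat \<Rightarrow> ('g \<Rightarrow> complex mat) \<Rightarrow> bool"
  where "irreducible_rep G n \<rho> \<longleftrightarrow>
    representation G n \<rho> \<and> 0 < n \<and>
    (\<forall>W. VectorSpace.subspace class_ring W (module_vec TYPE(complex) n) \<and>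
         (\<forall>g\<in>carrier G. \<forall>w\<in>W. \<rho> g *\<^sub>v w \<in> W)
       \<longrightarrow> W = {0\<^sub>v n} \<or> W = carrier_vec n)"

definition isomorphic_reps ::
    "('g, 'b) monoid_scheme \<Rightarrow> nat \<Rightarrow> ('g \<Rightarrow> complex mat) \<Rightarrow> nat \<Rightarrow> ('g \<Rightarrow> complex mat) \<Rightarrow> bool"
  where "isomorphic_reps G m \<rho> n \<sigma> \<longleftrightarrow>
    m = n \<and> (\<exists>P\<in>Units (ring_mat TYPE(complex) n ()). \<forall>g\<in>carrier G. P * \<rho> g = \<sigma> g * P)"

definition integer_valued_character_table :: "('g, 'b) monoid_scheme \<Rightarrow> bool"
  where "integer_valued_character_table G \<longleftrightarrow>
    (\<forall>n \<rho>. irreducible_rep G n \<rho> \<longrightarrow> (\<forall>g\<in>carrier G. mat_trace (\<rho> g) \<in> \<int>))"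

definition irrep_enumeration ::
    "('g, 'b) monoid_scheme \<Rightarrow> nat \<Rightarrow> (nat \<Rightarrow> nat) \<Rightarrow> (nat \<Rightarrow> 'g \<Rightarrow> complex mat) \<Rightarrow> bool"
  where "irrep_enumeration G k d V \<longleftrightarrow>
    (\<forall>i<k. irreducible_rep G (d i) (V i)) \<and>
    (\<forall>i<k. \<forall>j<k. isomorphic_reps G (d i) (V i) (d j) (V j) \<longrightarrow> i = j) \<and>
    (\<forall>n \<rho>. irreducible_rep G n \<rho> \<longrightarrow> (\<exists>i<k. isomorphic_reps G n \<rho> (d i) (V i)))"

definition conjugacy_classes :: "('g, 'b) monoid_scheme \<Rightarrow> 'g set set"
  where "conjugacy_classes G =
    Group_Action.orbits G (carrier G)
      (\<lambda>g. \<lambda>h\<in>carrier G. g \<otimes>\<^bsub>G\<^esub> h \<otimes>\<^bsub>G\<^esub> inv\<^bsub>G\<^esub> g)"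

text \<open>
  The induced representation in its usual block-matrix form: with respect to the basis
  \<open>t \<otimes> e\<^sub>i\<close>, where \<open>t\<close> runs through representatives of the left cosets of \<open>H\<close>, the block of \<open>x\<close>
  in row \<open>t\<close> and column \<open>u\<close> is \<open>\<rho> (t\<^sup>-\<^sup>1 x u)\<close> if \<open>t\<^sup>-\<^sup>1 x u \<in> H\<close>, and zero otherwise. A different
  choice of representatives gives an isomorphic representation.
\<close>

definition left_transversal :: "('w, 'b) monoid_scheme \<Rightarrow> 'w set \<Rightarrow> 'w list"
  where "left_transversal W H =
    (SOME ts. distinct ts \<and> set ts \<subseteq> carrier W \<and>
       (\<forall>x\<in>carrier W. \<exists>!t. t \<in> set ts \<and> x \<in> t <#\<^bsub>W\<^esub> H))"

definition induced_rep ::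
    "('w, 'b) monoid_scheme \<Rightarrow> 'w set \<Rightarrow> nat \<Rightarrow> ('w \<Rightarrow> complex mat) \<Rightarrow> 'w \<Rightarrow> complex mat"
  where "induced_rep W H n \<rho> x =
    (let bs = List.product (left_transversal W H) [0..<n]
     in mat (length bs) (length bs) (\<lambda>(r, s).
          let (t, i) = bs ! r; (u, j) = bs ! s; h = inv\<^bsub>W\<^esub> t \<otimes>\<^bsub>W\<^esub> x \<otimes>\<^bsub>W\<^esub> u
          in if h \<in> H then \<rho> h $$ (i, j) else 0))"

section \<open>The wreath product and its conjugacy classes\<close>

text \<open>
  The pair \<open>(f, \<sigma>)\<close> stands for the \<open>N \<times> N\<close> matrix whose nonzero entries are \<open>f a\<close> in row \<open>a\<close> and
  column \<open>\<sigma>\<^sup>-\<^sup>1 a\<close>, for \<open>a < N\<close>; the multiplication is the matrix product.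
\<close>

definition wreath ::
    "('g, 'b) monoid_scheme \<Rightarrow> nat \<Rightarrow> ((nat \<Rightarrow> 'g) \<times> (nat \<Rightarrow> nat)) monoid"
  where "wreath G N =
    \<lparr>carrier = ({..<N} \<rightarrow>\<^sub>E carrier G) \<times> {\<sigma>. \<sigma> permutes {..<N}},
     monoid.mult = (\<lambda>(f, \<sigma>) (g, \<tau>). (\<lambda>a\<in>{..<N}. f a \<otimes>\<^bsub>G\<^esub> g (inv_into UNIV \<sigma> a), \<sigma> \<circ> \<tau>)),
     one = (\<lambda>a\<in>{..<N}. \<one>\<^bsub>G\<^esub>, id)\<rparr>"

text \<open>
  The product \<open>f a \<cdot> f (\<sigma>\<^sup>-\<^sup>1 a) \<cdot> f (\<sigma>\<^sup>-\<^sup>2 a) \<cdots>\<close> around the cycle of \<open>a\<close>, i.e. the product of the matrix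
  entries at \<open>(a, \<sigma>\<^sup>-\<^sup>1 a), (\<sigma>\<^sup>-\<^sup>1 a, \<sigma>\<^sup>-\<^sup>2 a), \<dots>\<close>. Starting at another point of the cycle conjugates it.
\<close>

definition cycle_product ::
    "('g, 'b) monoid_scheme \<Rightarrow> (nat \<Rightarrow> 'g) \<times> (nat \<Rightarrow> nat) \<Rightarrow> nat \<Rightarrow> 'g"
  where "cycle_product G = (\<lambda>(f, \<sigma>) a.
    foldr (\<lambda>r y. f ((inv_into UNIV \<sigma> ^^ r) a) \<otimes>\<^bsub>G\<^esub> y) [0..<card (Orbits.orbit \<sigma> a)] \<one>\<^bsub>G\<^esub>)"

text \<open>A \<open>k\<close>-multipartition is a list of \<open>k\<close> partitions, a partition being the multiset of its parts.\<close>

definition multipartition :: "nat \<Rightarrow> nat \<Rightarrow> nat multiset list \<Rightarrow> bool"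
  where "multipartition k N \<mu> \<longleftrightarrow>
    length \<mu> = k \<and> (\<forall>\<kappa>\<in>set \<mu>. 0 \<notin># \<kappa>) \<and> (\<Sum>\<kappa>\<leftarrow>\<mu>. \<Sum>\<^sub># \<kappa>) = N"

definition cycle_type ::
    "('g, 'b) monoid_scheme \<Rightarrow> nat \<Rightarrow> nat \<Rightarrow> (nat \<Rightarrow> 'g set) \<Rightarrow> (nat \<Rightarrow> 'g) \<times> (nat \<Rightarrow> nat)
      \<Rightarrow> nat multiset list"
  where "cycle_type G N k C x =
    map (\<lambda>i. image_mset card (mset_set
           {c \<in> Orbits.orbit (snd x) ` {..<N}. \<exists>a\<in>c. cycle_product G x a \<in> C i})) [0..<k]"

definition wreath_class ::
    "('g, 'b) monoid_scheme \<Rightarrow> nat \<Rightarrow> nat \<Rightarrow> (nat \<Rightarrow> 'g set) \<Rightarrow> nat multiset list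
      \<Rightarrow> ((nat \<Rightarrow> 'g) \<times> (nat \<Rightarrow> nat)) set"
  where "wreath_class G N k C \<mu> = {x \<in> carrier (wreath G N). cycle_type G N k C x = \<mu>}"

section \<open>The modules \<open>M\<^sup>\<lambda>\<close>\<close>

text \<open>
  The \<open>N\<close> positions are split into consecutive blocks, one for each part of
  \<open>\<lambda>\<^sub>1\<close>, then one for each part of \<open>\<lambda>\<^sub>2\<close>, and so on. The colour of a position is the index \<open>i\<close>
  of the partition \<open>\<lambda>\<^sub>i\<close> to which its block belongs. The multipartition
  \<open>\<lambda>\<close> is written \<open>\<Lambda>\<close> in the formulas below.
\<close>

definition blocks :: "nat multiset list \<Rightarrow> nat list"
  where "blocks \<Lambda> = concat (map (\<lambda>\<kappa>. rev (sorted_list_of_multiset \<kappa>)) \<Lambda>)"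

definition block_index :: "nat list \<Rightarrow> nat list"
  where "block_index bl = concat (map (\<lambda>b. replicate (bl ! b) b) [0..<length bl])"

definition young_subgroup :: "nat list \<Rightarrow> (nat \<Rightarrow> nat) set"
  where "young_subgroup bl =
    {\<sigma>. \<sigma> permutes {..<sum_list bl} \<and>
        (\<forall>a<sum_list bl. block_index bl ! \<sigma> a = block_index bl ! a)}"

definition colours :: "nat multiset list \<Rightarrow> nat list"
  where "colours \<Lambda> = concat (map (\<lambda>i. replicate (\<Sum>\<^sub># (\<Lambda> ! i)) i) [0..<length \<Lambda>])"

text \<open>
  \<open>S\<^bsub>\<lambda>\<^sub>1\<^esub> \<times> \<cdots> \<times> S\<^bsub>\<lambda>\<^sub>k\<^esub> \<subseteq> S\<^sub>N\<close> is the Young subgroup of the concatenation of the \<open>\<lambda>\<^sub>i\<close>, and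
  \<open>G\<^bsub>\<lambda>\<^sub>1\<^esub> \<times> \<cdots> \<times> G\<^bsub>\<lambda>\<^sub>k\<^esub>\<close> consists of the elements of the wreath product lying over it.
\<close>

definition wreath_young :: "('g, 'b) monoid_scheme \<Rightarrow> nat multiset list
    \<Rightarrow> ((nat \<Rightarrow> 'g) \<times> (nat \<Rightarrow> nat)) set"
  where "wreath_young G \<Lambda> =
    ({..<sum_list (blocks \<Lambda>)} \<rightarrow>\<^sub>E carrier G) \<times> young_subgroup (blocks \<Lambda>)"

text \<open>
  The tensor product of the \<open>V (cs ! a)\<close> over the positions \<open>a\<close>, with the basis of elementary tensors
  \<open>e\<^bsub>b 0\<^esub> \<otimes> e\<^bsub>b 1\<^esub> \<otimes> \<cdots>\<close> in lexicographic order. The element \<open>(f, \<sigma>)\<close> sends the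
  tensor with factors \<open>v\<^sub>a\<close> to the one with factors \<open>f a v\<^bsub>\<sigma>\<^sup>-\<^sup>1 a\<^esub>\<close>; this makes sense when
  \<open>\<sigma>\<close> preserves \<open>cs\<close>.
\<close>

definition tensor_basis :: "(nat \<Rightarrow> nat) \<Rightarrow> nat list \<Rightarrow> nat list list"
  where "tensor_basis d cs = product_lists (map (\<lambda>i. [0..<d i]) cs)"

definition tensor_rep ::
    "(nat \<Rightarrow> nat) \<Rightarrow> (nat \<Rightarrow> 'g \<Rightarrow> complex mat) \<Rightarrow> nat list
      \<Rightarrow> (nat \<Rightarrow> 'g) \<times> (nat \<Rightarrow> nat) \<Rightarrow> complex mat"
  where "tensor_rep d V cs = (\<lambda>(f, \<sigma>).
    let bs = tensor_basis d cs
    in mat (length bs) (length bs) (\<lambda>(r, s).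
         \<Prod>a<length cs. V (cs ! a) (f a) $$ (bs ! r ! a, bs ! s ! inv_into UNIV \<sigma> a)))"

definition perm_module ::
    "('g, 'b) monoid_scheme \<Rightarrow> nat \<Rightarrow> (nat \<Rightarrow> nat) \<Rightarrow> (nat \<Rightarrow> 'g \<Rightarrow> complex mat)
      \<Rightarrow> nat multiset list \<Rightarrow> (nat \<Rightarrow> 'g) \<times> (nat \<Rightarrow> nat) \<Rightarrow> complex mat"
  where "perm_module G N d V \<Lambda> =
    induced_rep (wreath G N) (wreath_young G \<Lambda>)
      (length (tensor_basis d (colours \<Lambda>))) (tensor_rep d V (colours \<Lambda>))"

text \<open>\<open>M\<^sup>\<lambda>\<^sub>\<mu>\<close>, the common value of the character of \<open>M\<^sup>\<lambda>\<close> on the class indexed by \<open>\<mu>\<close>.\<close>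

definition perm_char ::
    "('g, 'b) monoid_scheme \<Rightarrow> nat \<Rightarrow> nat \<Rightarrow> (nat \<Rightarrow> 'g set) \<Rightarrow> (nat \<Rightarrow> nat)
      \<Rightarrow> (nat \<Rightarrow> 'g \<Rightarrow> complex mat) \<Rightarrow> nat multiset list \<Rightarrow> nat multiset list \<Rightarrow> complex"
  where "perm_char G N k C d V \<Lambda> \<mu> =
    (THE z. (\<lambda>x. mat_trace (perm_module G N d V \<Lambda> x)) ` wreath_class G N k C \<mu> = {z})"

section \<open>The relation \<open>\<sim>\<^sub>p\<close>\<close>

definition split_part :: "nat \<Rightarrow> nat multiset list \<Rightarrow> nat multiset list \<Rightarrow> bool"
  where "split_part p \<mu> \<nu> \<longleftrightarrow>
    length \<mu> = length \<nu> \<and>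
    (\<exists>j<length \<mu>. (\<forall>i<length \<mu>. i \<noteq> j \<longrightarrow> \<mu> ! i = \<nu> ! i) \<and>
       (\<exists>m\<ge>1. m * p \<in># \<mu> ! j \<and> \<nu> ! j = \<mu> ! j - {#m * p#} + replicate_mset p m))"

text \<open>
  For \<open>p > 0\<close>, \<open>split_part p\<close> relates a \<open>k\<close>-multipartition of \<open>N\<close> only to \<open>k\<close>-multipartitions
  of the same \<open>N\<close>, and conversely, so the closure need not be restricted to these.
\<close>

definition sim :: "nat \<Rightarrow> nat multiset list \<Rightarrow> nat multiset list \<Rightarrow> bool"
  where "sim p = equivclp (split_part p)"

end

theory Submission
  imports Defs "HOL-Library.Poly_Mapping"
begin

text \<open>
  The value \<open>M\<^sup>\<lambda>\<^sub>\<mu>\<close> is a coefficient of an explicit integer polynomial, and the step from \<open>\<mu>\<close> to \<open>\<nu>\<close>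
  changes that polynomial only by a multiple of \<open>p\<close>.

  Left cosets of the inducing subgroup correspond to the ways to distribute the \<open>N\<close> positions to the
  blocks of \<open>\<lambda>\<close>, with as many positions in each block as its size; an element \<open>(f, \<sigma>)\<close> fixes a coset
  iff the distribution is \<open>\<sigma>\<close>-invariant, that is, iff it sends whole cycles of \<open>\<sigma>\<close> to blocks. On
  a tensor power, the trace of such an element factors over the cycles, and a cycle that goes to a
  block of colour \<open>i\<close> contributes \<open>\<chi>\<^sub>i\<close> of its cycle product, since summing the matrix entries around the
  cycle computes the trace of the product of the matrices. Expanding a product of sums, one gets
  that \<open>M\<^sup>\<lambda>\<^sub>\<mu>\<close> is the coefficient of \<open>\<Prod>\<^sub>b x\<^sub>b\<close> to the power of the size of block \<open>b\<close> in
  \<open>\<Prod>\<^sub>i \<Prod>\<^bsub>r \<in> \<mu>\<^sub>i\<^esub> (\<Sum>\<^sub>b \<chi>\<^bsub>col b\<^esub>(C\<^sub>i) x\<^sub>b\<^sup>r),\<close>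
  where \<open>b\<close> runs through the blocks and \<open>col b\<close> is the colour of \<open>b\<close>
  (\<open>perm_char_eq_coefficient\<close>). The representation theory enters only through this formula, whose
  ingredients are \<open>mat_trace_tensor_rep\<close>, \<open>bij_betw_coset_colouring\<close> and
  \<open>mat_trace_perm_module\<close>.

  The character values are integers by hypothesis. Replacing a part \<open>m p\<close> of \<open>\<mu>\<^sub>j\<close> by \<open>p\<close> parts \<open>m\<close>
  replaces the factor \<open>\<Sum>\<^sub>b w\<^sub>b x\<^sub>b\<^bsup>m p\<^esup>\<close> by \<open>(\<Sum>\<^sub>b w\<^sub>b x\<^sub>b\<^bsup>m\<^esup>)\<^bsup>p\<^esup>\<close>, and these agree modulo \<open>p\<close> because the
  \<open>p\<close>-th power is additive modulo \<open>p\<close> and \<open>w\<^sup>p \<equiv> w\<close> by Fermat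
  (\<open>weighted_power_sum_mult_prime\<close>).

  Since \<open>M\<^sup>\<lambda>\<^sub>\<mu>\<close> is defined as the common value of a character on a class, one also has to know that
  the class is inhabited; this is \<open>wreath_class_nonempty\<close>.
\<close>

section \<open>Prime congruences between weighted power sums\<close>

lemma of_nat_dvd_of_nat: "m dvd n \<Longrightarrow> (of_nat m :: 'a :: comm_semiring_1) dvd of_nat n"
  by (auto elim!: dvdE)

text \<open>
  The additivity of the \<open>p\<close>-th power modulo \<open>p\<close>, stated as a divisibility so that it applies in a ring of
  characteristic zero: the inner binomial coefficients are multiples of \<open>p\<close>.
\<close>

lemma prime_dvd_power_sum_diff:
  fixes f :: "'b \<Rightarrow> 'a :: comm_ring_1"
  assumes "prime p"
  shows "of_nat p dvd (\<Sum>x\<in>A. f x) ^ p - (\<Sum>x\<in>A. f x ^ p)"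
proof (induction A rule: infinite_finite_induct)
  case (insert a A)
  define y where "y = (\<Sum>x\<in>A. f x)"
  have p: "p > 0" using assms prime_gt_0_nat by blast
  have "(f a + y) ^ p = (\<Sum>k\<le>p. of_nat (p choose k) * f a ^ k * y ^ (p - k))"
    by (rule binomial_ring)
  also have "{..p} = insert 0 (insert p {0<..<p})"
    using p by auto
  also have "(\<Sum>k\<in>\<dots>. of_nat (p choose k) * f a ^ k * y ^ (p - k)) =
      y ^ p + f a ^ p + (\<Sum>k\<in>{0<..<p}. of_nat (p choose k) * f a ^ k * y ^ (p - k))"
    using p by simp
  finally have "(f a + y) ^ p - (f a ^ p + y ^ p) =
      (\<Sum>k\<in>{0<..<p}. of_nat (p choose k) * f a ^ k * y ^ (p - k))"
    by simp
  also have "of_nat p dvd \<dots>"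
    by (intro dvd_sum dvd_mult2 of_nat_dvd_of_nat dvd_choose_prime) (use assms in auto)
  finally have "of_nat p dvd ((f a + y) ^ p - (f a ^ p + y ^ p)) + (y ^ p - (\<Sum>x\<in>A. f x ^ p))"
    using insert.IH unfolding y_def by (rule dvd_add)
  then show ?case
    using insert.hyps by (simp add: y_def algebra_simps)
qed (use assms prime_gt_0_nat[of p] in \<open>auto simp: power_0_left\<close>)

text \<open>
  Fermat's little theorem, here obtained from additivity of the \<open>p\<close>-th power by writing a natural number
  as a sum of ones.
\<close>

lemma prime_dvd_power_minus_self_int:
  assumes "prime p"
  shows "int p dvd a ^ p - a"
proof -
  have nat: "int p dvd int n ^ p - int n" for n
    using prime_dvd_power_sum_diff[OF assms, of "\<lambda>_. 1 :: int" "{..<n}"] by simp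
  \<comment> \<open>An arbitrary integer is replaced by its residue, which is a natural number.\<close>
  have "[a ^ p - a = (a mod int p) ^ p - a mod int p] (mod int p)"
    by (intro cong_diff cong_pow) (simp_all add: cong_def)
  moreover have "int p dvd (a mod int p) ^ p - a mod int p"
    using nat[of "nat (a mod int p)"] assms by (simp add: prime_gt_0_nat)
  ultimately show ?thesis
    using cong_dvd_iff cong_sym by blast
qed

type_synonym mpoly = "(nat \<Rightarrow>\<^sub>0 nat) \<Rightarrow>\<^sub>0 int"

text \<open>
  The polynomial \<open>\<Sum>\<^sub>b w\<^sub>b x\<^sub>b\<^sup>r\<close> in the variables \<open>x\<^sub>0, \<dots>, x\<^bsub>n - 1\<^esub>\<close>. A multivariate polynomial is a finitely
  supported function from exponent vectors to coefficients, with convolution as product.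
\<close>

definition weighted_power_sum :: "nat \<Rightarrow> (nat \<Rightarrow> int) \<Rightarrow> nat \<Rightarrow> mpoly"
  where "weighted_power_sum n w r =
    (\<Sum>b<n. Poly_Mapping.single (Poly_Mapping.single b r) (w b))"

lemma single_power:
  "Poly_Mapping.single (Poly_Mapping.single b m) (c :: int) ^ q =
   Poly_Mapping.single (Poly_Mapping.single b (m * q)) (c ^ q)"
  by (induction q) (auto simp: mult_single simp flip: single_add)

lemma single_dvd_single:
  "int p dvd c \<Longrightarrow> (of_nat p :: mpoly) dvd Poly_Mapping.single k c"
proof (elim dvdE)
  fix e assume "c = int p * e"
  then have "Poly_Mapping.single k c = of_nat p * Poly_Mapping.single k e"
    by (simp add: mult_single flip: single_of_nat)
  then show ?thesis by simp
qed

text \<open>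
  The heart of the congruence: additivity of the \<open>p\<close>-th power turns the power of the sum into the sum of
  \<open>w\<^sub>b\<^sup>p x\<^sub>b\<^bsup>m p\<^esup>\<close>, and Fermat removes the exponent of the weights.
\<close>

lemma weighted_power_sum_mult_prime:
  assumes "prime p"
  shows "of_nat p dvd weighted_power_sum n w (m * p) - weighted_power_sum n w m ^ p"
proof -
  let ?t = "\<lambda>b. Poly_Mapping.single (Poly_Mapping.single b m) (w b) :: mpoly"
  have "of_nat p dvd (\<Sum>b<n. Poly_Mapping.single (Poly_Mapping.single b (m * p)) (w b ^ p - w b) :: mpoly)"
    by (intro dvd_sum single_dvd_single prime_dvd_power_minus_self_int assms)
  also have "\<dots> = (\<Sum>b<n. ?t b ^ p) - weighted_power_sum n w (m * p)"
    by (simp add: weighted_power_sum_def single_power single_diff sum_subtractf)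
  finally have "of_nat p dvd ((\<Sum>b<n. ?t b) ^ p - (\<Sum>b<n. ?t b ^ p)) +
      ((\<Sum>b<n. ?t b ^ p) - weighted_power_sum n w (m * p))"
    by (intro dvd_add prime_dvd_power_sum_diff assms)
  then have "of_nat p dvd - (weighted_power_sum n w m ^ p - weighted_power_sum n w (m * p))"
    by (subst dvd_minus_iff) (simp add: weighted_power_sum_def)
  then show ?thesis by simp
qed

text \<open>
  The polynomial of which the character values are coefficients; \<open>w i b\<close> will be the value on the class
  \<open>C i\<close> of the irreducible character that belongs to block \<open>b\<close>.
\<close>

definition class_polynomial :: "nat \<Rightarrow> (nat \<Rightarrow> nat \<Rightarrow> int) \<Rightarrow> nat multiset list \<Rightarrow> mpoly"
  where "class_polynomial n w \<mu> =
    (\<Prod>i<length \<mu>. \<Prod>r\<in>#\<mu> ! i. weighted_power_sum n (w i) r)"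

lemma class_polynomial_split_part:
  assumes "prime p" and "split_part p \<mu> \<nu>"
  shows "of_nat p dvd class_polynomial n w \<mu> - class_polynomial n w \<nu>"
proof -
  obtain j m where len: "length \<mu> = length \<nu>" and j: "j < length \<mu>"
    and other: "\<And>i. i < length \<mu> \<Longrightarrow> i \<noteq> j \<Longrightarrow> \<mu> ! i = \<nu> ! i"
    and mp: "m * p \<in># \<mu> ! j" and \<nu>j: "\<nu> ! j = \<mu> ! j - {#m * p#} + replicate_mset p m"
    using assms(2) unfolding split_part_def by blast
  let ?F = "\<lambda>\<kappa> i. \<Prod>r\<in>#\<kappa>. weighted_power_sum n (w i) r"
  define R where "R = (\<Prod>i\<in>{..<length \<mu>} - {j}. ?F (\<mu> ! i) i)"
  define Q where "Q = ?F (\<mu> ! j - {#m * p#}) j"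
  have "class_polynomial n w \<mu> = ?F (\<mu> ! j) j * R"
    unfolding class_polynomial_def R_def using j by (subst prod.remove[of _ j]) auto
  also have "\<mu> ! j = add_mset (m * p) (\<mu> ! j - {#m * p#})"
    using mp by simp
  also have "?F \<dots> j = weighted_power_sum n (w j) (m * p) * Q"
    by (simp add: Q_def)
  finally have \<mu>: "class_polynomial n w \<mu> = weighted_power_sum n (w j) (m * p) * Q * R" .
  have "class_polynomial n w \<nu> = ?F (\<nu> ! j) j * (\<Prod>i\<in>{..<length \<mu>} - {j}. ?F (\<nu> ! i) i)"
    unfolding class_polynomial_def using j len by (subst prod.remove[of _ j]) auto
  also have "(\<Prod>i\<in>{..<length \<mu>} - {j}. ?F (\<nu> ! i) i) = R"
    unfolding R_def using other by (intro prod.cong) auto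
  also have "?F (\<nu> ! j) j = weighted_power_sum n (w j) m ^ p * Q"
    unfolding \<nu>j Q_def by simp
  finally have "class_polynomial n w \<mu> - class_polynomial n w \<nu> =
      (weighted_power_sum n (w j) (m * p) - weighted_power_sum n (w j) m ^ p) * (Q * R)"
    using \<mu> by (simp add: algebra_simps)
  then show ?thesis
    using weighted_power_sum_mult_prime[OF assms(1)] by simp
qed

lemma class_polynomial_sim:
  assumes "prime p" and "sim p \<mu> \<nu>"
  shows "of_nat p dvd class_polynomial n w \<mu> - class_polynomial n w \<nu>"
  using assms(2) unfolding sim_def
proof (induction rule: equivclp_induct)
  case base
  then show ?case by simp
next
  case (step \<nu> \<kappa>)
  have "of_nat p dvd class_polynomial n w \<nu> - class_polynomial n w \<kappa>"
    using step.hyps(2)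
  proof
    assume "split_part p \<kappa> \<nu>"
    from class_polynomial_split_part[OF assms(1) this, of n w]
    show ?thesis by (metis dvd_minus_iff minus_diff_eq)
  qed (rule class_polynomial_split_part[OF assms(1)])
  with step.IH have "of_nat p dvd (class_polynomial n w \<mu> - class_polynomial n w \<nu>) +
      (class_polynomial n w \<nu> - class_polynomial n w \<kappa>)"
    by (rule dvd_add)
  then show ?case by simp
qed

lemma lookup_cong_mod:
  assumes "(of_nat p :: mpoly) dvd f - g"
  shows "[Poly_Mapping.lookup f k = Poly_Mapping.lookup g k] (mod int p)"
proof -
  obtain h where "f - g = of_nat p * h" using assms by (elim dvdE)
  then have "Poly_Mapping.lookup (f - g) k = Poly_Mapping.lookup (of_nat p * h) k"
    by simp
  also have "of_nat p * h = (\<Sum>_<p. h)"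
    by simp
  finally have "Poly_Mapping.lookup f k - Poly_Mapping.lookup g k = int p * Poly_Mapping.lookup h k"
    by (simp add: lookup_minus lookup_sum del: sum_constant) simp
  then show ?thesis
    by (simp add: cong_iff_dvd_diff)
qed


text \<open>
  Expanding the product selects one variable \<open>\<gamma> c\<close> from each factor \<open>c\<close>; the resulting monomial is the
  prescribed one iff the exponents selected for each variable add up correctly.
\<close>

lemma lookup_prod_weighted_power_sum:
  assumes "finite A"
  shows "Poly_Mapping.lookup (\<Prod>c\<in>A. weighted_power_sum n (w c) (r c))
      (\<Sum>b<n. Poly_Mapping.single b (m b)) =
    (\<Sum>\<gamma> | \<gamma> \<in> A \<rightarrow>\<^sub>E {..<n} \<and> (\<forall>b<n. (\<Sum>c | c \<in> A \<and> \<gamma> c = b. r c) = m b).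
      \<Prod>c\<in>A. w c (\<gamma> c))"
proof -
  define M where "M = (\<Sum>b<n. Poly_Mapping.single b (m b))"
  define E where "E \<gamma> = (\<Sum>c\<in>A. Poly_Mapping.single (\<gamma> c) (r c))" for \<gamma> :: "'a \<Rightarrow> nat"
  have prod_single: "(\<Prod>c\<in>B. Poly_Mapping.single (Poly_Mapping.single (\<gamma> c) (r c)) (w c (\<gamma> c))) =
      Poly_Mapping.single (\<Sum>c\<in>B. Poly_Mapping.single (\<gamma> c) (r c)) (\<Prod>c\<in>B. w c (\<gamma> c))"
    if "finite B" for B and \<gamma> :: "'a \<Rightarrow> nat"
    using that by (induction rule: finite_induct) (auto simp: mult_single)
  have lookup_M: "Poly_Mapping.lookup M x = (if x < n then m x else 0)" for x
    unfolding M_def lookup_sum lookup_single when_def by simp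
  have lookup_E: "Poly_Mapping.lookup (E \<gamma>) b = (\<Sum>c | c \<in> A \<and> \<gamma> c = b. r c)" for \<gamma> b
    unfolding E_def lookup_sum lookup_single when_def
    using assms by (simp add: sum.If_cases Int_def)
  have E_eq_M: "E \<gamma> = M \<longleftrightarrow> (\<forall>b<n. (\<Sum>c | c \<in> A \<and> \<gamma> c = b. r c) = m b)"
    if "\<gamma> \<in> A \<rightarrow>\<^sub>E {..<n}" for \<gamma>
  proof -
    have "(\<Sum>c | c \<in> A \<and> \<gamma> c = b. r c) = 0" if "\<not> b < n" for b
      using that \<open>\<gamma> \<in> A \<rightarrow>\<^sub>E {..<n}\<close> by (intro sum.neutral) (auto simp: PiE_iff)
    then show ?thesis
      unfolding poly_mapping_eq_iff fun_eq_iff lookup_M lookup_E by (simp split: if_split)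
  qed
  have "(\<Prod>c\<in>A. weighted_power_sum n (w c) (r c)) =
      (\<Sum>\<gamma>\<in>A \<rightarrow>\<^sub>E {..<n}. Poly_Mapping.single (E \<gamma>) (\<Prod>c\<in>A. w c (\<gamma> c)))"
    unfolding weighted_power_sum_def using assms
    by (subst prod_sum_PiE) (auto simp: prod_single E_def)
  then have "Poly_Mapping.lookup (\<Prod>c\<in>A. weighted_power_sum n (w c) (r c)) M =
      (\<Sum>\<gamma>\<in>A \<rightarrow>\<^sub>E {..<n}. (if E \<gamma> = M then \<Prod>c\<in>A. w c (\<gamma> c) else 0))"
    by (simp add: lookup_sum lookup_single when_def)
  also have "\<dots> = (\<Sum>\<gamma> | \<gamma> \<in> A \<rightarrow>\<^sub>E {..<n} \<and> E \<gamma> = M. \<Prod>c\<in>A. w c (\<gamma> c))"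
    using assms by (simp add: sum.If_cases finite_PiE Int_def)
  also have "\<dots> = (\<Sum>\<gamma> | \<gamma> \<in> A \<rightarrow>\<^sub>E {..<n} \<and> (\<forall>b<n. (\<Sum>c | c \<in> A \<and> \<gamma> c = b. r c) = m b).
      \<Prod>c\<in>A. w c (\<gamma> c))"
    using E_eq_M by (intro sum.cong) auto
  finally show ?thesis unfolding M_def .
qed

section \<open>Traces of products of matrices around a cycle\<close>

lemma sum_PiE_insert:
  assumes "a \<notin> A"
  shows "(\<Sum>g\<in>PiE (insert a A) T. F g) = (\<Sum>g\<in>PiE A T. \<Sum>y\<in>T a. F (g(a := y)))"
proof -
  have "(\<Sum>g\<in>PiE (insert a A) T. F g) = (\<Sum>(y, g)\<in>T a \<times> PiE A T. F (g(a := y)))"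
    unfolding PiE_insert_eq using assms
    by (subst sum.reindex) (auto simp: inj_combinator case_prod_beta)
  also have "\<dots> = (\<Sum>y\<in>T a. \<Sum>g\<in>PiE A T. F (g(a := y)))"
    by (rule sum.cartesian_product[symmetric])
  finally show ?thesis by (subst sum.swap)
qed

lemma sum_PiE_Un_disjoint:
  fixes F H :: "('a \<Rightarrow> 'b) \<Rightarrow> 'c :: comm_semiring_1"
  assumes "A \<inter> B = {}"
    and F: "\<And>g h. (\<And>a. a \<in> A \<Longrightarrow> g a = h a) \<Longrightarrow> F g = F h"
    and H: "\<And>g h. (\<And>a. a \<in> B \<Longrightarrow> g a = h a) \<Longrightarrow> H g = H h"
  shows "(\<Sum>g\<in>PiE (A \<union> B) T. F g * H g) = (\<Sum>g\<in>PiE A T. F g) * (\<Sum>g\<in>PiE B T. H g)"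
proof -
  let ?join = "\<lambda>g h a. if a \<in> A then g a else h a"
  have disj: "a \<notin> A" if "a \<in> B" for a using assms(1) that by auto
  have "(\<Sum>g\<in>PiE A T. F g) * (\<Sum>g\<in>PiE B T. H g) = (\<Sum>(g, h)\<in>PiE A T \<times> PiE B T. F g * H h)"
    by (simp add: sum_product sum.cartesian_product)
  also have "\<dots> = (\<Sum>g\<in>PiE (A \<union> B) T. F g * H g)"
  proof (rule sum.reindex_bij_witness[where j = "\<lambda>x. ?join (fst x) (snd x)"
        and i = "\<lambda>g. (restrict g A, restrict g B)"])
    fix x assume "x \<in> PiE A T \<times> PiE B T"
    then obtain g h where x: "x = (g, h)" and g: "g \<in> PiE A T" and h: "h \<in> PiE B T" by auto
    have "restrict (?join g h) A = g"
      by (rule ext) (use g in \<open>auto simp: PiE_iff extensional_def\<close>)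
    moreover have "restrict (?join g h) B = h"
      by (rule ext) (use h disj in \<open>auto simp: PiE_iff extensional_def\<close>)
    ultimately show "(restrict (?join (fst x) (snd x)) A, restrict (?join (fst x) (snd x)) B) = x"
      unfolding x fst_conv snd_conv by simp
    show "?join (fst x) (snd x) \<in> PiE (A \<union> B) T"
      using g h by (auto simp: x PiE_iff extensional_def)
    have "F (?join g h) = F g" by (rule F) simp
    moreover have "H (?join g h) = H h" by (rule H) (simp add: disj)
    ultimately show "F (?join (fst x) (snd x)) * H (?join (fst x) (snd x)) = (case x of (g, h) \<Rightarrow> F g * H h)"
      unfolding x fst_conv snd_conv prod.case by simp
  next
    fix g assume g: "g \<in> PiE (A \<union> B) T"
    show "?join (fst (restrict g A, restrict g B)) (snd (restrict g A, restrict g B)) = g"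
      by (rule ext) (use g in \<open>auto simp: PiE_iff extensional_def\<close>)
    show "(restrict g A, restrict g B) \<in> PiE A T \<times> PiE B T"
      using g by auto
  qed
  finally show ?thesis by simp
qed

text \<open>
  Distributivity in the form needed for tensor products: when the summand splits into factors that each
  depend on the values in one cell of a partition only, the sum over all index functions factors too.
\<close>

lemma sum_PiE_Union_disjoint:
  fixes F :: "'a set \<Rightarrow> ('a \<Rightarrow> 'b) \<Rightarrow> 'c :: comm_semiring_1"
  assumes "finite P" and "disjoint P"
    and "\<And>c g h. c \<in> P \<Longrightarrow> (\<And>a. a \<in> c \<Longrightarrow> g a = h a) \<Longrightarrow> F c g = F c h"
  shows "(\<Sum>g\<in>PiE (\<Union>P) T. \<Prod>c\<in>P. F c g) = (\<Prod>c\<in>P. \<Sum>g\<in>PiE c T. F c g)"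
  using assms
proof (induction rule: finite_induct)
  case (insert c P)
  have "(\<Sum>g\<in>PiE (\<Union>(insert c P)) T. \<Prod>c\<in>insert c P. F c g) =
      (\<Sum>g\<in>PiE (c \<union> \<Union>P) T. F c g * (\<Prod>c\<in>P. F c g))"
    using insert.hyps by simp
  also have "\<dots> = (\<Sum>g\<in>PiE c T. F c g) * (\<Sum>g\<in>PiE (\<Union>P) T. \<Prod>c\<in>P. F c g)"
  proof (rule sum_PiE_Un_disjoint)
    show "c \<inter> \<Union>P = {}"
      using insert.prems(1) insert.hyps(2) by (auto simp: pairwise_insert disjnt_def)
    show "F c g = F c h" if "\<And>a. a \<in> c \<Longrightarrow> g a = h a" for g h
      by (rule insert.prems(2)) (simp_all add: that)
    show "(\<Prod>c\<in>P. F c g) = (\<Prod>c\<in>P. F c h)" if "\<And>a. a \<in> \<Union>P \<Longrightarrow> g a = h a" for g h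
      by (intro prod.cong refl insert.prems(2)) (use that in auto)
  qed
  also have "(\<Sum>g\<in>PiE (\<Union>P) T. \<Prod>c\<in>P. F c g) = (\<Prod>c\<in>P. \<Sum>g\<in>PiE c T. F c g)"
  proof (rule insert.IH)
    show "disjoint P" using insert.prems(1) by (simp add: pairwise_insert)
    show "F c g = F c h" if "c \<in> P" "\<And>a. a \<in> c \<Longrightarrow> g a = h a" for c g h
      by (rule insert.prems(2)) (simp_all add: that)
  qed
  finally show ?case using insert.hyps by simp
qed simp

lemma mat_trace_carrier: "A \<in> carrier_mat n n \<Longrightarrow> mat_trace A = (\<Sum>i<n. A $$ (i, i))"
  by (simp add: mat_trace_def)

text \<open>
  The trace of a product of matrices is the sum over closed paths of indices. The last factor \<open>Y\<close> is kept
  apart so that the induction can absorb one more matrix into it.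
\<close>

lemma mat_trace_foldr_mult:
  assumes "\<And>r. r < l \<Longrightarrow> M r \<in> carrier_mat n n" and "Y \<in> carrier_mat n n"
  shows "mat_trace (foldr (\<lambda>r Z. M r * Z) [0..<l] Y) =
    (\<Sum>e\<in>{..l} \<rightarrow>\<^sub>E {..<n}. (\<Prod>r<l. M r $$ (e r, e (Suc r))) * Y $$ (e l, e 0))"
  using assms
proof (induction l arbitrary: Y)
  case 0
  have "(\<Sum>e\<in>{..0 :: nat} \<rightarrow>\<^sub>E {..<n}. Y $$ (e 0, e 0)) = (\<Sum>e\<in>{0 :: nat} \<rightarrow>\<^sub>E {..<n}. Y $$ (e 0, e 0))"
    by simp
  also have "\<dots> = (\<Sum>i<n. Y $$ (i, i))"
    using sum_PiE_insert[of "0 :: nat" "{}" "\<lambda>e. Y $$ (e 0, e 0)" "\<lambda>_. {..<n}"] by simp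
  finally show ?case using 0 by (simp add: mat_trace_carrier)
next
  case (Suc l)
  have MY: "(M l * Y) $$ (i, j) = (\<Sum>y<n. M l $$ (i, y) * Y $$ (y, j))" if "i < n" "j < n" for i j
    using that Suc.prems(1)[of l] Suc.prems(2)
    by (auto simp: times_mat_def scalar_prod_def lessThan_atLeast0)
  have "mat_trace (foldr (\<lambda>r Z. M r * Z) [0..<Suc l] Y) =
      mat_trace (foldr (\<lambda>r Z. M r * Z) [0..<l] (M l * Y))"
    by simp
  also have "\<dots> = (\<Sum>e\<in>{..l} \<rightarrow>\<^sub>E {..<n}. (\<Prod>r<l. M r $$ (e r, e (Suc r))) * (M l * Y) $$ (e l, e 0))"
    using Suc.prems by (intro Suc.IH mult_carrier_mat[of _ n n]) auto
  also have "\<dots> = (\<Sum>e\<in>{..l} \<rightarrow>\<^sub>E {..<n}. \<Sum>y<n.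
      (\<Prod>r<l. M r $$ (e r, e (Suc r))) * M l $$ (e l, y) * Y $$ (y, e 0))"
  proof (intro sum.cong refl)
    fix e assume "e \<in> {..l} \<rightarrow>\<^sub>E {..<n}"
    then have "e l < n" "e 0 < n" by auto
    then show "(\<Prod>r<l. M r $$ (e r, e (Suc r))) * (M l * Y) $$ (e l, e 0) =
        (\<Sum>y<n. (\<Prod>r<l. M r $$ (e r, e (Suc r))) * M l $$ (e l, y) * Y $$ (y, e 0))"
      by (simp only: MY sum_distrib_left mult.assoc)
  qed
  also have "\<dots> = (\<Sum>e\<in>{..l} \<rightarrow>\<^sub>E {..<n}. \<Sum>y<n.
      (\<Prod>r<Suc l. M r $$ ((e(Suc l := y)) r, (e(Suc l := y)) (Suc r))) *
        Y $$ ((e(Suc l := y)) (Suc l), (e(Suc l := y)) 0))"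
    by (intro sum.cong refl) simp
  also have "\<dots> = (\<Sum>e\<in>{..Suc l} \<rightarrow>\<^sub>E {..<n}.
      (\<Prod>r<Suc l. M r $$ (e r, e (Suc r))) * Y $$ (e (Suc l), e 0))"
    unfolding atMost_Suc by (subst sum_PiE_insert) auto
  finally show ?case .
qed

lemma funpow_bij_betw_orbit:
  fixes s :: "'a \<Rightarrow> 'a" and a :: 'a
  assumes "permutation s"
  defines "l \<equiv> card (Orbits.orbit s a)"
  shows "bij_betw (\<lambda>r. (s ^^ r) a) {..<l} (Orbits.orbit s a)" and "(s ^^ l) a = a" and "l > 0"
proof -
  have a: "a \<in> Orbits.orbit s a"
    using assms by (simp add: permutation_self_in_orbit)
  let ?m = "funpow_dist1 s a a"
  have im: "Orbits.orbit s a = (\<lambda>r. (s ^^ r) a) ` {0..<?m}"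
    by (rule orbit_conv_funpow_dist1[OF a])
  have inj: "inj_on (\<lambda>r. (s ^^ r) a) {0..<?m}"
    by (rule inj_on_funpow_dist1[OF a])
  have l: "l = ?m"
    unfolding l_def by (subst im) (simp add: card_image[OF inj])
  show "bij_betw (\<lambda>r. (s ^^ r) a) {..<l} (Orbits.orbit s a)"
    unfolding l lessThan_atLeast0 by (intro bij_betw_imageI inj im[symmetric])
  show "(s ^^ l) a = a" unfolding l by (rule funpow_dist1_prop[OF a])
  show "l > 0" unfolding l by simp
qed

text \<open>
  The sum over closed paths with the steps of the path labelled by the points of a cycle instead of by numbers.
\<close>

lemma closed_path_sum_orbit:
  assumes s: "permutation s" and M: "\<And>b. b \<in> Orbits.orbit s a \<Longrightarrow> M b \<in> carrier_mat n n"
  shows "(\<Sum>e\<in>Orbits.orbit s a \<rightarrow>\<^sub>E {..<n}. \<Prod>b\<in>Orbits.orbit s a. M b $$ (e b, e (s b))) =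
    mat_trace (foldr (\<lambda>r Z. M ((s ^^ r) a) * Z) [0..<card (Orbits.orbit s a)] (1\<^sub>m n))"
proof -
  define c where "c = Orbits.orbit s a"
  obtain l where l: "card c = Suc l"
    using funpow_bij_betw_orbit(3)[OF s, of a] unfolding c_def by (metis Suc_pred)
  define h where "h r = (s ^^ r) a" for r
  have bij: "bij_betw h {..l} c"
    using funpow_bij_betw_orbit(1)[OF s, of a] l unfolding h_def c_def lessThan_Suc_atMost[symmetric] by simp
  have s_h: "s (h r) = h (Suc r)" for r by (simp add: h_def)
  have s_hl: "s (h l) = h 0"
    using funpow_bij_betw_orbit(2)[OF s, of a] l unfolding h_def c_def by simp
  have inj: "inv_into {..l} h (h r) = r" if "r \<le> l" for r
    using bij that by (simp add: bij_betw_def inv_into_f_f)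
  have hc: "h r \<in> c" if "r \<le> l" for r
    using bij that by (auto simp: bij_betw_def)
  have h_inv: "inv_into {..l} h b \<le> l" "h (inv_into {..l} h b) = b" if "b \<in> c" for b
    using that bij inv_into_into[of b h "{..l}"] f_inv_into_f[of b h "{..l}"] by (auto simp: bij_betw_def)
  have Mh: "M (h r) \<in> carrier_mat n n" if "r \<le> l" for r
    using M bij that unfolding c_def by (auto simp: bij_betw_def)
  \<comment> \<open>The last matrix takes the place of \<open>Y\<close>: it closes the path by leading back to the starting point.\<close>
  have "foldr (\<lambda>r Z. M (h r) * Z) [0..<Suc l] (1\<^sub>m n) = foldr (\<lambda>r Z. M (h r) * Z) [0..<l] (M (h l))"
    using Mh[of l] by simp
  then have "mat_trace (foldr (\<lambda>r Z. M (h r) * Z) [0..<card c] (1\<^sub>m n)) =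
      (\<Sum>e\<in>{..l} \<rightarrow>\<^sub>E {..<n}. (\<Prod>r<l. M (h r) $$ (e r, e (Suc r))) * M (h l) $$ (e l, e 0))"
    unfolding l using Mh by (simp add: mat_trace_foldr_mult)
  also have "\<dots> = (\<Sum>e\<in>c \<rightarrow>\<^sub>E {..<n}. \<Prod>b\<in>c. M b $$ (e b, e (s b)))"
  proof (rule sum.reindex_bij_witness[where i = "\<lambda>e. \<lambda>r\<in>{..l}. e (h r)" and
        j = "\<lambda>e. \<lambda>b\<in>c. e (inv_into {..l} h b)"], goal_cases)
    case (3 e)
    show ?case
    proof
      fix b
      show "(\<lambda>b\<in>c. (\<lambda>r\<in>{..l}. e (h r)) (inv_into {..l} h b)) b = e b"
        using 3 h_inv[of b] by (cases "b \<in> c") (auto simp: PiE_iff extensional_def)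
    qed
  next
    case (4 e)
    then show ?case using bij by (auto simp: PiE_iff bij_betw_def)
  next
    case (1 e)
    show ?case
    proof
      fix r
      show "(\<lambda>r\<in>{..l}. (\<lambda>b\<in>c. e (inv_into {..l} h b)) (h r)) r = e r"
        using 1 hc[of r] inj[of r] by (cases "r \<le> l") (auto simp: PiE_iff extensional_def)
    qed
  next
    case (2 e)
    then show ?case using h_inv by (auto simp: PiE_iff)
  next
    case (5 e)
    let ?e = "\<lambda>b\<in>c. e (inv_into {..l} h b)"
    have "(\<Prod>b\<in>c. M b $$ (?e b, ?e (s b))) = (\<Prod>r\<le>l. M (h r) $$ (?e (h r), ?e (s (h r))))"
      by (rule prod.reindex_bij_betw[OF bij, symmetric])
    also have "\<dots> = (\<Prod>r<l. M (h r) $$ (?e (h r), ?e (s (h r)))) * M (h l) $$ (?e (h l), ?e (s (h l)))"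
      unfolding lessThan_Suc_atMost[symmetric] by simp
    also have "(\<Prod>r<l. M (h r) $$ (?e (h r), ?e (s (h r)))) = (\<Prod>r<l. M (h r) $$ (e r, e (Suc r)))"
      by (intro prod.cong refl) (auto simp: hc inj s_h)
    also have "M (h l) $$ (?e (h l), ?e (s (h l))) = M (h l) $$ (e l, e 0)"
      by (simp add: hc inj s_hl)
    finally show ?case by simp
  qed
  finally show ?thesis unfolding c_def h_def by simp
qed


lemma representationD:
  assumes "representation G n \<rho>" and "group G"
  shows "g \<in> carrier G \<Longrightarrow> \<rho> g \<in> carrier_mat n n"
    and "g \<in> carrier G \<Longrightarrow> h \<in> carrier G \<Longrightarrow> \<rho> (g \<otimes>\<^bsub>G\<^esub> h) = \<rho> g * \<rho> h"
    and "\<rho> \<one>\<^bsub>G\<^esub> = 1\<^sub>m n"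
proof -
  let ?R = "ring_mat TYPE(complex) n ()"
  interpret R: ring ?R by (rule ring_mat)
  interpret group_hom G "units_of ?R" \<rho>
    using assms by (simp add: group_hom_def group_hom_axioms_def representation_def R.units_group)
  show "g \<in> carrier G \<Longrightarrow> \<rho> g \<in> carrier_mat n n"
    using hom_closed[of g] by (auto simp: units_of_carrier Units_def ring_mat_simps)
  show "g \<in> carrier G \<Longrightarrow> h \<in> carrier G \<Longrightarrow> \<rho> (g \<otimes>\<^bsub>G\<^esub> h) = \<rho> g * \<rho> h"
    using hom_mult[of g h] by (simp add: units_of_mult ring_mat_simps)
  show "\<rho> \<one>\<^bsub>G\<^esub> = 1\<^sub>m n"
    using hom_one by (simp add: units_of_one ring_mat_simps)
qed

lemma mat_trace_mult_commute:
  assumes A: "A \<in> carrier_mat n n" and B: "B \<in> carrier_mat n n"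
  shows "mat_trace (A * B) = mat_trace (B * A)"
proof -
  have "mat_trace (A * B) = (\<Sum>i<n. \<Sum>j<n. A $$ (i, j) * B $$ (j, i))"
    using assms by (auto simp: mat_trace_def scalar_prod_def lessThan_atLeast0)
  also have "\<dots> = (\<Sum>j<n. \<Sum>i<n. B $$ (j, i) * A $$ (i, j))"
    by (subst sum.swap) (simp add: mult.commute)
  also have "\<dots> = mat_trace (B * A)"
    using assms by (auto simp: mat_trace_def scalar_prod_def lessThan_atLeast0)
  finally show ?thesis .
qed

lemma mat_trace_conjugate:
  assumes \<rho>: "representation G n \<rho>" and G: "group G" and g: "g \<in> carrier G" and h: "h \<in> carrier G"
  shows "mat_trace (\<rho> (h \<otimes>\<^bsub>G\<^esub> g \<otimes>\<^bsub>G\<^esub> inv\<^bsub>G\<^esub> h)) = mat_trace (\<rho> g)"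
proof -
  interpret group G by (rule G)
  note D = representationD[OF \<rho> G]
  have "mat_trace (\<rho> (h \<otimes>\<^bsub>G\<^esub> g \<otimes>\<^bsub>G\<^esub> inv\<^bsub>G\<^esub> h)) = mat_trace (\<rho> (h \<otimes>\<^bsub>G\<^esub> g) * \<rho> (inv\<^bsub>G\<^esub> h))"
    using g h by (simp add: D(2))
  also have "\<dots> = mat_trace (\<rho> (inv\<^bsub>G\<^esub> h) * \<rho> (h \<otimes>\<^bsub>G\<^esub> g))"
    using g h by (intro mat_trace_mult_commute[of _ n] D(1)) auto
  also have "\<rho> (inv\<^bsub>G\<^esub> h) * \<rho> (h \<otimes>\<^bsub>G\<^esub> g) = \<rho> g"
  proof -
    have "inv\<^bsub>G\<^esub> h \<otimes>\<^bsub>G\<^esub> (h \<otimes>\<^bsub>G\<^esub> g) = g"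
      using g h by (simp flip: m_assoc)
    then show ?thesis
      using g h D(2)[of "inv\<^bsub>G\<^esub> h" "h \<otimes>\<^bsub>G\<^esub> g"] by (metis inv_closed m_closed)
  qed
  finally show ?thesis .
qed

lemma foldr_mult_closed:
  assumes "group G" and "\<And>r. r \<in> set xs \<Longrightarrow> f r \<in> carrier G"
  shows "foldr (\<lambda>r y. f r \<otimes>\<^bsub>G\<^esub> y) xs \<one>\<^bsub>G\<^esub> \<in> carrier G"
proof -
  interpret group G by fact
  show ?thesis using assms(2) by (induction xs) auto
qed

lemma representation_foldr_mult:
  assumes \<rho>: "representation G n \<rho>" and G: "group G" and f: "\<And>r. r \<in> set xs \<Longrightarrow> f r \<in> carrier G"
  shows "\<rho> (foldr (\<lambda>r y. f r \<otimes>\<^bsub>G\<^esub> y) xs \<one>\<^bsub>G\<^esub>) = foldr (\<lambda>r Z. \<rho> (f r) * Z) xs (1\<^sub>m n)"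
  using f by (induction xs) (auto simp: representationD[OF \<rho> G] foldr_mult_closed[OF G])

text \<open>
  The basis of elementary tensors is a list of index lists, whereas products of sums produce extensional
  index functions; this converts sums over the former into sums over the latter.
\<close>

lemma sum_tensor_basis:
  "(\<Sum>r<length (tensor_basis d cs). F (\<lambda>a. if a < length cs then tensor_basis d cs ! r ! a else undefined)) =
    (\<Sum>e\<in>PiE {..<length cs} (\<lambda>a. {..<d (cs ! a)}). F e)"
proof -
  define bs where "bs = tensor_basis d cs"
  have set_bs: "set bs = {v. length v = length cs \<and> (\<forall>a<length cs. v ! a < d (cs ! a))}"
    unfolding bs_def tensor_basis_def product_lists_set by (auto simp: list_all2_conv_all_nth)
  have dist: "distinct bs"
    unfolding bs_def tensor_basis_def by (rule distinct_product_lists) auto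
  let ?fun = "\<lambda>v a. if a < length cs then v ! a else undefined"
  have "(\<Sum>r<length bs. F (?fun (bs ! r))) = (\<Sum>v\<in>set bs. F (?fun v))"
    using sum.reindex_bij_betw[OF bij_betw_nth[OF dist refl refl], of "\<lambda>v. F (?fun v)"] by simp
  also have "\<dots> = (\<Sum>e\<in>PiE {..<length cs} (\<lambda>a. {..<d (cs ! a)}). F e)"
    by (rule sum.reindex_bij_witness[where j = "\<lambda>v a. if a < length cs then v ! a else undefined"
          and i = "\<lambda>e. map e [0..<length cs]"])
      (auto simp: set_bs PiE_iff extensional_def intro!: nth_equalityI ext)
  finally show ?thesis unfolding bs_def .
qed

lemma permutes_orbits:
  assumes "\<sigma> permutes {..<N :: nat}"
  shows "\<Union>(Orbits.orbit \<sigma> ` {..<N}) = {..<N}" and "disjoint (Orbits.orbit \<sigma> ` {..<N})"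
    and "c \<in> Orbits.orbit \<sigma> ` {..<N} \<Longrightarrow> a \<in> c \<Longrightarrow> c = Orbits.orbit \<sigma> a"
proof -
  have perm: "permutation \<sigma>" using assms by (auto simp: permutation_permutes)
  have eq: "Orbits.orbit \<sigma> b = Orbits.orbit \<sigma> a" if "a \<in> Orbits.orbit \<sigma> b" for a b
    using orbit_cyclic_eq3[OF cyclic_on_orbit'[OF perm] that] by simp
  show "c \<in> Orbits.orbit \<sigma> ` {..<N} \<Longrightarrow> a \<in> c \<Longrightarrow> c = Orbits.orbit \<sigma> a"
    using eq by auto
  show "\<Union>(Orbits.orbit \<sigma> ` {..<N}) = {..<N}"
  proof
    show "\<Union>(Orbits.orbit \<sigma> ` {..<N}) \<subseteq> {..<N}"
      by (rule UN_least) (rule permutes_orbit_subset[OF assms])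
    show "{..<N} \<subseteq> \<Union>(Orbits.orbit \<sigma> ` {..<N})"
      using permutation_self_in_orbit[OF perm] by auto
  qed
  show "disjoint (Orbits.orbit \<sigma> ` {..<N})"
  proof (rule pairwiseI)
    fix c c' assume "c \<in> Orbits.orbit \<sigma> ` {..<N}" "c' \<in> Orbits.orbit \<sigma> ` {..<N}" "c \<noteq> c'"
    then obtain a b where *: "c = Orbits.orbit \<sigma> a" "c' = Orbits.orbit \<sigma> b" by auto
    show "disjnt c c'"
    proof (rule ccontr)
      assume "\<not> disjnt c c'"
      then obtain x where "x \<in> c" "x \<in> c'" by (auto simp: disjnt_def)
      then show False using eq[of x a] eq[of x b] * \<open>c \<noteq> c'\<close> by simp
    qed
  qed
qed

lemma cycle_product_closed:
  assumes "group G" and "\<sigma> permutes {..<N}" and "a < N" and "\<And>a. a < N \<Longrightarrow> f a \<in> carrier G"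
  shows "cycle_product G (f, \<sigma>) a \<in> carrier G"
proof -
  have "(inv_into UNIV \<sigma> ^^ r) a < N" for r
    using permutes_in_image[OF permutes_inv[OF assms(2)]] assms(3) by (induction r) auto
  then show ?thesis
    unfolding cycle_product_def using assms by (auto intro!: foldr_mult_closed)
qed

text \<open>
  A diagonal entry of the matrix of \<open>(f, \<sigma>)\<close> is a product over positions that couples the index at \<open>a\<close> with
  the index at \<open>\<sigma>\<^sup>-\<^sup>1 a\<close>, hence only indices in the same cycle. So the trace factors over the cycles, each
  factor being a closed path sum. The choice \<open>pt\<close> of starting points is left free, which lets a conjugate
  element use the transported starting points.
\<close>

lemma mat_trace_tensor_rep:
  assumes G: "group G" and \<sigma>: "\<sigma> permutes {..<length cs}"
    and cs: "\<And>a. a < length cs \<Longrightarrow> cs ! \<sigma> a = cs ! a"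
    and f: "\<And>a. a < length cs \<Longrightarrow> f a \<in> carrier G"
    and V: "\<And>a. a < length cs \<Longrightarrow> representation G (d (cs ! a)) (V (cs ! a))"
    and pt: "\<And>c. c \<in> Orbits.orbit \<sigma> ` {..<length cs} \<Longrightarrow> pt c \<in> c"
  shows "mat_trace (tensor_rep d V cs (f, \<sigma>)) =
    (\<Prod>c\<in>Orbits.orbit \<sigma> ` {..<length cs}. mat_trace (V (cs ! pt c) (cycle_product G (f, \<sigma>) (pt c))))"
proof -
  define N where "N = length cs"
  define P where "P = Orbits.orbit \<sigma> ` {..<N}"
  define s where "s = inv_into UNIV \<sigma>"
  note \<sigma>' = \<sigma>[folded N_def]
  note UP = permutes_orbits(1,2)[OF \<sigma>', folded P_def]
  have s: "s permutes {..<N}" unfolding s_def using \<sigma>' by (rule permutes_inv)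
  have perm_s: "permutation s" using s by (auto simp: permutation_permutes)
  have perm: "permutation \<sigma>" using \<sigma> by (auto simp: permutation_permutes)
  have orbit_s: "Orbits.orbit s a = Orbits.orbit \<sigma> a" for a
    unfolding s_def by (rule orbit_inv_eq[OF perm])
  have s_N: "s a < N" if "a < N" for a
    using that permutes_in_image[OF s] by auto
  have s_P: "s a \<in> c" if "c \<in> P" "a \<in> c" for c a
    using that permutes_orbits(3)[OF \<sigma>'] unfolding P_def by (metis orbit.base orbit_s)
  have term_eq: "tensor_rep d V cs (f, \<sigma>) $$ (r, r) =
      (\<Prod>a<N. V (cs ! a) (f a) $$ (e a, e (s a)))"
    if "r < length (tensor_basis d cs)"
      and "e = (\<lambda>a. if a < length cs then tensor_basis d cs ! r ! a else undefined)" for r e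
    using that s_N unfolding tensor_rep_def N_def s_def by (auto simp: Let_def intro!: prod.cong)
  have "mat_trace (tensor_rep d V cs (f, \<sigma>)) = (\<Sum>r<length (tensor_basis d cs). tensor_rep d V cs (f, \<sigma>) $$ (r, r))"
    by (simp add: mat_trace_def tensor_rep_def Let_def)
  also have "\<dots> = (\<Sum>e\<in>PiE {..<N} (\<lambda>a. {..<d (cs ! a)}). \<Prod>a<N. V (cs ! a) (f a) $$ (e a, e (s a)))"
    unfolding N_def sum_tensor_basis[symmetric]
    by (intro sum.cong refl term_eq[unfolded N_def]) auto
  also have "\<dots> = (\<Sum>e\<in>PiE (\<Union>P) (\<lambda>a. {..<d (cs ! a)}). \<Prod>c\<in>P. \<Prod>a\<in>c. V (cs ! a) (f a) $$ (e a, e (s a)))"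
  proof (intro sum.cong)
    fix e
    have "finite c" if "c \<in> P" for c
      using that UP(1) finite_subset[of c "{..<N}"] by auto
    then show "(\<Prod>a<N. V (cs ! a) (f a) $$ (e a, e (s a))) = (\<Prod>c\<in>P. \<Prod>a\<in>c. V (cs ! a) (f a) $$ (e a, e (s a)))"
      using UP by (subst UP(1)[symmetric], subst prod.Union_disjoint) (auto simp: pairwise_def disjnt_def)
  qed (simp add: UP)
  also have "\<dots> = (\<Prod>c\<in>P. \<Sum>e\<in>PiE c (\<lambda>a. {..<d (cs ! a)}). \<Prod>a\<in>c. V (cs ! a) (f a) $$ (e a, e (s a)))"
  proof (rule sum_PiE_Union_disjoint)
    show "finite P" unfolding P_def by simp
    show "disjoint P" by (rule UP)
    show "(\<Prod>a\<in>c. V (cs ! a) (f a) $$ (g a, g (s a))) = (\<Prod>a\<in>c. V (cs ! a) (f a) $$ (h a, h (s a)))"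
      if "c \<in> P" "\<And>a. a \<in> c \<Longrightarrow> g a = h a" for c g h
      using that s_P by (intro prod.cong refl) auto
  qed
  also have "\<dots> = (\<Prod>c\<in>P. mat_trace (V (cs ! pt c) (cycle_product G (f, \<sigma>) (pt c))))"
  proof (intro prod.cong refl)
    fix c assume c: "c \<in> P"
    define a where "a = pt c"
    have ca: "c = Orbits.orbit s a"
      using permutes_orbits(3)[OF \<sigma>', folded P_def, OF c] pt c unfolding a_def P_def N_def orbit_s by blast
    have c_N: "b < N" if "b \<in> c" for b using UP(1) c that by auto
    have const: "cs ! b = cs ! a" if "b \<in> Orbits.orbit \<sigma> a" for b
    proof -
      have "a \<in> c" using pt c unfolding a_def P_def N_def by blast
      have "Orbits.orbit \<sigma> a \<subseteq> {..<N}" by (rule permutes_orbit_subset[OF \<sigma>']) (use c_N \<open>a \<in> c\<close> in auto)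
      with that show ?thesis
      proof (induction)
        case base
        then show ?case using cs[of a] c_N[OF \<open>a \<in> c\<close>] by (simp add: N_def)
      next
        case (step b)
        then show ?case using cs[of b] by (auto simp: N_def)
      qed
    qed
    have aN: "a < N" using pt c c_N unfolding a_def P_def N_def by blast
    note rep = V[OF aN[unfolded N_def]]
    have "(s ^^ r) a \<in> c" for r
      using pt c s_P[OF c] unfolding a_def P_def N_def by (induction r) auto
    then have fr: "f ((s ^^ r) a) \<in> carrier G" for r
      using f c_N unfolding N_def by blast
    have "(\<Sum>e\<in>PiE c (\<lambda>a. {..<d (cs ! a)}). \<Prod>a\<in>c. V (cs ! a) (f a) $$ (e a, e (s a))) =
        (\<Sum>e\<in>c \<rightarrow>\<^sub>E {..<d (cs ! a)}. \<Prod>b\<in>c. V (cs ! a) (f b) $$ (e b, e (s b)))"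
      using const unfolding ca orbit_s by (intro sum.cong PiE_cong prod.cong) auto
    also have "\<dots> = mat_trace (foldr (\<lambda>r Z. V (cs ! a) (f ((s ^^ r) a)) * Z) [0..<card c] (1\<^sub>m (d (cs ! a))))"
      unfolding ca
      by (rule closed_path_sum_orbit[OF perm_s])
        (use f c_N in \<open>auto intro!: representationD[OF rep G] simp: N_def simp flip: ca\<close>)
    also have "\<dots> = mat_trace (V (cs ! a) (cycle_product G (f, \<sigma>) a))"
      unfolding cycle_product_def using representation_foldr_mult[OF rep G, of "[0..<card c]" "\<lambda>r. f ((s ^^ r) a)"] fr
      by (simp add: s_def[symmetric] ca orbit_s)
    finally show "(\<Sum>e\<in>PiE c (\<lambda>a. {..<d (cs ! a)}). \<Prod>a\<in>c. V (cs ! a) (f a) $$ (e a, e (s a))) =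
        mat_trace (V (cs ! pt c) (cycle_product G (f, \<sigma>) (pt c)))"
      unfolding a_def .
  qed
  finally show ?thesis unfolding P_def N_def .
qed

section \<open>Wreath products, induced representations and cosets as colourings\<close>

lemma wreath_simps:
  "carrier (wreath G N) = ({..<N} \<rightarrow>\<^sub>E carrier G) \<times> {\<sigma>. \<sigma> permutes {..<N}}"
  "(f, \<sigma>) \<otimes>\<^bsub>wreath G N\<^esub> (g, \<tau>) = (\<lambda>a\<in>{..<N}. f a \<otimes>\<^bsub>G\<^esub> g (inv_into UNIV \<sigma> a), \<sigma> \<circ> \<tau>)"
  "\<one>\<^bsub>wreath G N\<^esub> = (\<lambda>a\<in>{..<N}. \<one>\<^bsub>G\<^esub>, id)"
  by (simp_all add: wreath_def)

lemma permutes_inv_lessThan: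
  fixes \<sigma> :: "nat \<Rightarrow> nat"
  assumes "\<sigma> permutes {..<N}" and "a < N"
  shows "inv_into UNIV \<sigma> a < N"
  using permutes_in_image[OF permutes_inv[OF assms(1)], of a] assms(2) by auto

lemma permutes_lessThan:
  fixes \<sigma> :: "nat \<Rightarrow> nat"
  assumes "\<sigma> permutes {..<N}" and "a < N"
  shows "\<sigma> a < N"
  using permutes_in_image[OF assms(1), of a] assms(2) by auto

lemma wreath_inv_mult:
  assumes "group G" and "(g, \<tau>) \<in> carrier (wreath G N)"
  shows "(\<lambda>a\<in>{..<N}. inv\<^bsub>G\<^esub> g (\<tau> a), inv_into UNIV \<tau>) \<otimes>\<^bsub>wreath G N\<^esub> (g, \<tau>) = \<one>\<^bsub>wreath G N\<^esub>"
proof -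
  interpret group G by fact
  have \<tau>: "\<tau> permutes {..<N}" and g: "\<And>a. a < N \<Longrightarrow> g a \<in> carrier G"
    using assms(2) by (auto simp: wreath_simps)
  have "inv_into UNIV (inv_into UNIV \<tau>) = \<tau>"
    using \<tau> by (simp add: inv_inv_eq permutes_bij)
  then show ?thesis
    using g permutes_lessThan[OF \<tau>] \<tau> by (auto simp: wreath_simps restrict_def permutes_inv_o)
qed

lemma group_wreath:
  assumes "group G"
  shows "group (wreath G N)"
proof (rule groupI)
  interpret group G by fact
  fix x y z
  assume x: "x \<in> carrier (wreath G N)" and y: "y \<in> carrier (wreath G N)"
  obtain f \<sigma> g \<tau> where xy: "x = (f, \<sigma>)" "y = (g, \<tau>)" by (metis surj_pair)
  have \<sigma>: "\<sigma> permutes {..<N}" and \<tau>: "\<tau> permutes {..<N}"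
    and f: "\<And>a. a < N \<Longrightarrow> f a \<in> carrier G" and g: "\<And>a. a < N \<Longrightarrow> g a \<in> carrier G"
    using x y by (auto simp: xy wreath_simps)
  show "x \<otimes>\<^bsub>wreath G N\<^esub> y \<in> carrier (wreath G N)"
    using f g permutes_inv_lessThan[OF \<sigma>] permutes_compose[OF \<tau> \<sigma>]
    by (auto simp: xy wreath_simps)
  show "\<one>\<^bsub>wreath G N\<^esub> \<otimes>\<^bsub>wreath G N\<^esub> x = x"
    using x f by (auto simp: xy wreath_simps fun_eq_iff PiE_iff extensional_def)
  show "\<exists>y\<in>carrier (wreath G N). y \<otimes>\<^bsub>wreath G N\<^esub> x = \<one>\<^bsub>wreath G N\<^esub>"
    using wreath_inv_mult[OF assms, of f \<sigma> N] x f permutes_lessThan[OF \<sigma>] permutes_inv[OF \<sigma>]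
    by (intro bexI[of _ "(\<lambda>a\<in>{..<N}. inv\<^bsub>G\<^esub> f (\<sigma> a), inv_into UNIV \<sigma>)"]) (auto simp: xy wreath_simps)
  assume z: "z \<in> carrier (wreath G N)"
  obtain h \<rho> where z': "z = (h, \<rho>)" by (metis surj_pair)
  have h: "\<And>a. a < N \<Longrightarrow> h a \<in> carrier G" using z by (auto simp: z' wreath_simps)
  have "inv_into UNIV (\<sigma> \<circ> \<tau>) = inv_into UNIV \<tau> \<circ> inv_into UNIV \<sigma>"
    using \<sigma> \<tau> by (simp add: o_inv_distrib permutes_bij)
  then show "x \<otimes>\<^bsub>wreath G N\<^esub> y \<otimes>\<^bsub>wreath G N\<^esub> z = x \<otimes>\<^bsub>wreath G N\<^esub> (y \<otimes>\<^bsub>wreath G N\<^esub> z)"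
    using f g h permutes_inv_lessThan[OF \<sigma>] permutes_inv_lessThan[OF \<tau>]
    by (auto simp: xy z' wreath_simps fun_eq_iff m_assoc)
qed (use assms group.is_monoid[THEN monoid.one_closed] in \<open>auto simp: wreath_simps permutes_id\<close>)

lemma wreath_inv:
  assumes "group G" and "(g, \<tau>) \<in> carrier (wreath G N)"
  shows "inv\<^bsub>wreath G N\<^esub> (g, \<tau>) = (\<lambda>a\<in>{..<N}. inv\<^bsub>G\<^esub> g (\<tau> a), inv_into UNIV \<tau>)"
proof -
  interpret group G by fact
  have \<tau>: "\<tau> permutes {..<N}" and g: "\<And>a. a < N \<Longrightarrow> g a \<in> carrier G"
    using assms(2) by (auto simp: wreath_simps)
  show ?thesis
    using g permutes_lessThan[OF \<tau>] permutes_inv[OF \<tau>]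
    by (intro group.inv_equality[OF group_wreath] wreath_inv_mult assms) (auto simp: wreath_simps)
qed

lemma wreath_conjugate:
  assumes "group G" and x: "(f, \<sigma>) \<in> carrier (wreath G N)" and t: "(g, \<tau>) \<in> carrier (wreath G N)"
  shows "inv\<^bsub>wreath G N\<^esub> (g, \<tau>) \<otimes>\<^bsub>wreath G N\<^esub> (f, \<sigma>) \<otimes>\<^bsub>wreath G N\<^esub> (g, \<tau>) =
    (\<lambda>a\<in>{..<N}. inv\<^bsub>G\<^esub> g (\<tau> a) \<otimes>\<^bsub>G\<^esub> f (\<tau> a) \<otimes>\<^bsub>G\<^esub> g (inv_into UNIV \<sigma> (\<tau> a)), inv_into UNIV \<tau> \<circ> \<sigma> \<circ> \<tau>)"
proof -
  have \<tau>: "\<tau> permutes {..<N}" and \<sigma>: "\<sigma> permutes {..<N}"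
    using x t by (auto simp: wreath_simps)
  have "inv_into UNIV (inv_into UNIV \<tau> \<circ> \<sigma>) = inv_into UNIV \<sigma> \<circ> \<tau>"
    using \<sigma> \<tau> by (simp add: o_inv_distrib permutes_bij permutes_inv inv_inv_eq bij_imp_bij_inv)
  moreover have "inv_into UNIV (inv_into UNIV \<tau>) = \<tau>"
    using \<tau> by (simp add: inv_inv_eq permutes_bij)
  ultimately show ?thesis
    unfolding wreath_inv[OF assms(1) t] using assms(1) by (auto simp: wreath_simps fun_eq_iff)
qed

lemma mat_trace_induced_rep:
  assumes "distinct (left_transversal W H)"
  shows "mat_trace (induced_rep W H n \<rho> x) =
    (\<Sum>t | t \<in> set (left_transversal W H) \<and> inv\<^bsub>W\<^esub> t \<otimes>\<^bsub>W\<^esub> x \<otimes>\<^bsub>W\<^esub> t \<in> H.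
       \<Sum>i<n. \<rho> (inv\<^bsub>W\<^esub> t \<otimes>\<^bsub>W\<^esub> x \<otimes>\<^bsub>W\<^esub> t) $$ (i, i))"
proof -
  let ?ts = "left_transversal W H"
  define bs where "bs = List.product ?ts [0..<n]"
  define F where "F = (\<lambda>(t, i). let h = inv\<^bsub>W\<^esub> t \<otimes>\<^bsub>W\<^esub> x \<otimes>\<^bsub>W\<^esub> t in if h \<in> H then \<rho> h $$ (i, i) else 0)"
  have "mat_trace (induced_rep W H n \<rho> x) = (\<Sum>r<length bs. F (bs ! r))"
    unfolding mat_trace_def induced_rep_def bs_def F_def
    by (auto simp: Let_def case_prod_beta intro!: sum.cong)
  also have "\<dots> = (\<Sum>b\<in>set bs. F b)"
    using assms by (intro sum.reindex_bij_betw bij_betw_nth) (auto simp: bs_def distinct_product)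
  also have "\<dots> = (\<Sum>t\<in>set ?ts. \<Sum>i<n. F (t, i))"
    by (simp add: bs_def sum.cartesian_product lessThan_atLeast0)
  also have "\<dots> = (\<Sum>t\<in>set ?ts. if inv\<^bsub>W\<^esub> t \<otimes>\<^bsub>W\<^esub> x \<otimes>\<^bsub>W\<^esub> t \<in> H
      then \<Sum>i<n. \<rho> (inv\<^bsub>W\<^esub> t \<otimes>\<^bsub>W\<^esub> x \<otimes>\<^bsub>W\<^esub> t) $$ (i, i) else 0)"
    by (intro sum.cong) (auto simp: F_def Let_def)
  finally show ?thesis by (simp add: sum.If_cases Int_def)
qed

lemma block_index_append:
  "block_index (xs @ ys) = block_index xs @ map (\<lambda>b. length xs + b) (block_index ys)"
proof -
  have "block_index (xs @ ys) =
      concat (map (\<lambda>b. replicate ((xs @ ys) ! b) b) [0..<length xs]) @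
      concat (map (\<lambda>b. replicate ((xs @ ys) ! b) b) (map (\<lambda>b. b + length xs) [0..<length ys]))"
    unfolding block_index_def map_add_upt length_append
      upt_add_eq_append[of 0 "length xs" "length ys", simplified] by (simp add: add.commute)
  also have "map (\<lambda>b. replicate ((xs @ ys) ! b) b) [0..<length xs] = map (\<lambda>b. replicate (xs ! b) b) [0..<length xs]"
    by (simp add: nth_append)
  finally show ?thesis
    unfolding block_index_def by (simp add: map_concat comp_def nth_append add.commute)
qed

lemma length_block_index: "length (block_index bl) = sum_list bl"
proof -
  have "length (block_index bl) = sum_list (map (\<lambda>b. bl ! b) [0..<length bl])"
    by (simp add: block_index_def length_concat comp_def)
  then show ?thesis by (simp only: map_nth)
qed

lemma set_block_index: "set (block_index bl) \<subseteq> {..<length bl}"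
  by (auto simp: block_index_def)

lemma block_index_less: "a < sum_list bl \<Longrightarrow> block_index bl ! a < length bl"
  using set_block_index[of bl] nth_mem[of a "block_index bl"] unfolding length_block_index by blast

lemma count_block_index:
  assumes "b < length bl"
  shows "card {a. a < sum_list bl \<and> block_index bl ! a = b} = bl ! b"
proof -
  have "card {a. a < sum_list bl \<and> block_index bl ! a = b} = length (filter (\<lambda>c. c = b) (block_index bl))"
    by (simp add: length_filter_conv_card length_block_index)
  also have "\<dots> = sum_list (map (\<lambda>c. if c = b then bl ! c else 0) [0..<length bl])"
    by (auto simp: block_index_def filter_concat length_concat comp_def filter_replicate
        intro!: arg_cong[where f = sum_list] map_cong)
  also have "\<dots> = (\<Sum>c<length bl. if c = b then bl ! c else 0)"
    by (simp add: sum_list_distinct_conv_sum_set lessThan_atLeast0)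
  finally show ?thesis using assms by simp
qed

text \<open>
  The colour of a position depends only on its block.
\<close>

lemma colours_eq_map_block_index:
  "\<exists>col. (\<forall>b<length (blocks \<Lambda>). col b < length \<Lambda>) \<and> colours \<Lambda> = map col (block_index (blocks \<Lambda>))"
proof (induction \<Lambda> rule: rev_induct)
  case Nil
  show ?case by (simp add: blocks_def colours_def block_index_def)
next
  case (snoc \<kappa> \<Lambda>)
  then obtain col where col: "\<forall>b<length (blocks \<Lambda>). col b < length \<Lambda>"
    and eq: "colours \<Lambda> = map col (block_index (blocks \<Lambda>))" by blast
  define xs where "xs = rev (sorted_list_of_multiset \<kappa>)"
  have xs: "sum_list xs = \<Sum>\<^sub># \<kappa>"
    by (simp add: xs_def flip: sum_mset_sum_list)
  have bl: "blocks (\<Lambda> @ [\<kappa>]) = blocks \<Lambda> @ xs"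
    by (simp add: blocks_def xs_def)
  define col' where "col' b = (if b < length (blocks \<Lambda>) then col b else length \<Lambda>)" for b
  have old: "map (\<lambda>i. replicate (\<Sum>\<^sub># ((\<Lambda> @ [\<kappa>]) ! i)) i) [0..<length \<Lambda>] =
      map (\<lambda>i. replicate (\<Sum>\<^sub># (\<Lambda> ! i)) i) [0..<length \<Lambda>]"
    by (intro map_cong) (auto simp: nth_append)
  have "colours (\<Lambda> @ [\<kappa>]) = colours \<Lambda> @ replicate (\<Sum>\<^sub># \<kappa>) (length \<Lambda>)"
    by (simp add: colours_def old)
  also have "colours \<Lambda> = map col' (block_index (blocks \<Lambda>))"
    unfolding eq using set_block_index[of "blocks \<Lambda>"] by (auto simp: col'_def)
  also have "replicate (\<Sum>\<^sub># \<kappa>) (length \<Lambda>) = map col' (map (\<lambda>b. length (blocks \<Lambda>) + b) (block_index xs))"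
    by (simp add: col'_def comp_def map_replicate_const length_block_index xs)
  finally have "colours (\<Lambda> @ [\<kappa>]) = map col' (block_index (blocks (\<Lambda> @ [\<kappa>])))"
    by (simp add: bl block_index_append)
  moreover have "\<forall>b<length (blocks (\<Lambda> @ [\<kappa>])). col' b < length (\<Lambda> @ [\<kappa>])"
    using col by (auto simp: col'_def less_SucI)
  ultimately show ?case by blast
qed

lemma sum_list_blocks: "sum_list (blocks \<Lambda>) = (\<Sum>\<kappa>\<leftarrow>\<Lambda>. \<Sum>\<^sub># \<kappa>)"
  unfolding blocks_def by (induction \<Lambda>) (simp_all flip: sum_mset_sum_list)

text \<open>
  The invariant that separates the cosets of \<open>wreath_young\<close>: to each position, the block from which the
  permutation moves a position there.
\<close>

definition coset_colouring :: "nat list \<Rightarrow> (nat \<Rightarrow> 'g) \<times> (nat \<Rightarrow> nat) \<Rightarrow> nat \<Rightarrow> nat"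
  where "coset_colouring bl x = (\<lambda>a\<in>{..<sum_list bl}. block_index bl ! inv_into UNIV (snd x) a)"

definition block_colourings :: "nat list \<Rightarrow> (nat \<Rightarrow> nat) set"
  where "block_colourings bl = {\<beta> \<in> {..<sum_list bl} \<rightarrow>\<^sub>E {..<length bl}.
    \<forall>b<length bl. card {a. a < sum_list bl \<and> \<beta> a = b} = bl ! b}"

text \<open>
  The base group \<open>G\<^sup>N\<close> is contained in the subgroup, so a coset only remembers the permutation \<open>\<sigma>\<close>, and only
  up to the Young subgroup, that is, the blocks to which \<open>\<sigma>\<^sup>-\<^sup>1\<close> sends the positions.
\<close>

lemma coset_colouring_eq_iff:
  assumes G: "group G" and N: "N = sum_list (blocks \<Lambda>)"
    and x: "x \<in> carrier (wreath G N)" and t: "t \<in> carrier (wreath G N)"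
  shows "x \<in> t <#\<^bsub>wreath G N\<^esub> wreath_young G \<Lambda> \<longleftrightarrow>
    coset_colouring (blocks \<Lambda>) x = coset_colouring (blocks \<Lambda>) t"
proof -
  interpret G: group G by fact
  interpret W: group "wreath G N" by (rule group_wreath[OF G])
  define bi where "bi = block_index (blocks \<Lambda>)"
  obtain f \<sigma> g \<tau> where xt: "x = (f, \<sigma>)" "t = (g, \<tau>)" by (metis surj_pair)
  have \<sigma>: "\<sigma> permutes {..<N}" and \<tau>: "\<tau> permutes {..<N}"
    using x t by (auto simp: xt wreath_simps)
  define y where "y = inv\<^bsub>wreath G N\<^esub> t \<otimes>\<^bsub>wreath G N\<^esub> x"
  have y: "y \<in> carrier (wreath G N)" unfolding y_def using x t by simp
  have snd_y: "snd y = inv_into UNIV \<tau> \<circ> \<sigma>"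
    unfolding y_def xt wreath_inv[OF G t[unfolded xt]] by (simp add: wreath_simps)
  have "x \<in> t <#\<^bsub>wreath G N\<^esub> wreath_young G \<Lambda> \<longleftrightarrow> y \<in> wreath_young G \<Lambda>"
  proof
    assume "x \<in> t <#\<^bsub>wreath G N\<^esub> wreath_young G \<Lambda>"
    then obtain h where h: "h \<in> wreath_young G \<Lambda>" "x = t \<otimes>\<^bsub>wreath G N\<^esub> h"
      by (auto simp: l_coset_def)
    have "h \<in> carrier (wreath G N)"
      using h(1) by (auto simp: wreath_young_def wreath_simps young_subgroup_def N)
    then have "y = h"
      unfolding y_def h(2) using t by (simp add: W.m_assoc[symmetric])
    with h show "y \<in> wreath_young G \<Lambda>" by simp
  next
    assume "y \<in> wreath_young G \<Lambda>"
    moreover have "x = t \<otimes>\<^bsub>wreath G N\<^esub> y"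
      unfolding y_def using x t by (simp add: W.m_assoc[symmetric])
    ultimately show "x \<in> t <#\<^bsub>wreath G N\<^esub> wreath_young G \<Lambda>"
      by (auto simp: l_coset_def)
  qed
  also have "\<dots> \<longleftrightarrow> (\<forall>a<N. bi ! (snd y a) = bi ! a)"
    using y by (cases y) (auto simp: wreath_young_def young_subgroup_def wreath_simps bi_def simp flip: N)
  also have "\<dots> \<longleftrightarrow> (\<forall>a<N. bi ! (inv_into UNIV \<tau> a) = bi ! (inv_into UNIV \<sigma> a))"
  proof safe
    fix a assume *: "\<forall>a<N. bi ! (snd y a) = bi ! a" "a < N"
    have "snd y (inv_into UNIV \<sigma> a) = inv_into UNIV \<tau> a"
      unfolding snd_y using permutes_inverses(1)[OF \<sigma>] by simp
    then show "bi ! (inv_into UNIV \<tau> a) = bi ! (inv_into UNIV \<sigma> a)"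
      using *(1)[rule_format, OF permutes_inv_lessThan[OF \<sigma> \<open>a < N\<close>]] by simp
  next
    fix a assume *: "\<forall>a<N. bi ! (inv_into UNIV \<tau> a) = bi ! (inv_into UNIV \<sigma> a)" "a < N"
    show "bi ! (snd y a) = bi ! a"
      using *(1)[rule_format, OF permutes_lessThan[OF \<sigma> *(2)]] permutes_inverses(2)[OF \<sigma>]
      unfolding snd_y by simp
  qed
  also have "\<dots> \<longleftrightarrow> coset_colouring (blocks \<Lambda>) x = coset_colouring (blocks \<Lambda>) t"
  proof
    assume "\<forall>a<N. bi ! (inv_into UNIV \<tau> a) = bi ! (inv_into UNIV \<sigma> a)"
    then show "coset_colouring (blocks \<Lambda>) x = coset_colouring (blocks \<Lambda>) t"
      unfolding coset_colouring_def xt snd_conv bi_def N[symmetric] by (intro restrict_ext) simp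
  next
    assume eq: "coset_colouring (blocks \<Lambda>) x = coset_colouring (blocks \<Lambda>) t"
    show "\<forall>a<N. bi ! (inv_into UNIV \<tau> a) = bi ! (inv_into UNIV \<sigma> a)"
    proof safe
      fix a assume "a < N"
      then show "bi ! (inv_into UNIV \<tau> a) = bi ! (inv_into UNIV \<sigma> a)"
        using fun_cong[OF eq, of a] by (simp add: coset_colouring_def xt bi_def flip: N)
    qed
  qed
  finally show ?thesis .
qed

lemma coset_colouring_in_block_colourings:
  assumes "snd x permutes {..<sum_list bl}"
  shows "coset_colouring bl x \<in> block_colourings bl"
proof -
  define s where "s = inv_into UNIV (snd x)"
  have s: "s permutes {..<sum_list bl}" unfolding s_def using assms by (rule permutes_inv)
  have "card {a. a < sum_list bl \<and> coset_colouring bl x a = b} = bl ! b" if "b < length bl" for b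
  proof -
    have "bij_betw s {a. a < sum_list bl \<and> coset_colouring bl x a = b} {a. a < sum_list bl \<and> block_index bl ! a = b}"
    proof (rule bij_betw_byWitness[where f' = "snd x"])
      show "s ` {a. a < sum_list bl \<and> coset_colouring bl x a = b} \<subseteq> {a. a < sum_list bl \<and> block_index bl ! a = b}"
        using permutes_lessThan[OF s] by (auto simp: coset_colouring_def s_def)
      show "snd x ` {a. a < sum_list bl \<and> block_index bl ! a = b} \<subseteq> {a. a < sum_list bl \<and> coset_colouring bl x a = b}"
        using permutes_lessThan[OF assms] permutes_inverses(2)[OF assms] by (auto simp: coset_colouring_def)
    qed (use permutes_inverses[OF assms] in \<open>auto simp: s_def\<close>)
    then show ?thesis using count_block_index[OF that] by (simp add: bij_betw_same_card)
  qed
  moreover have "coset_colouring bl x \<in> {..<sum_list bl} \<rightarrow>\<^sub>E {..<length bl}"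
    using permutes_lessThan[OF s] block_index_less[of _ bl] by (auto simp: coset_colouring_def s_def)
  ultimately show ?thesis by (simp add: block_colourings_def)
qed

lemma count_mset_eq_card_nth: "count (mset xs) b = card {i. i < length xs \<and> xs ! i = b}"
  unfolding count_mset count_list_eq_length_filter length_filter_conv_card by (intro arg_cong[where f = card]) auto

text \<open>
  A distribution with the right block sizes is a rearrangement of the list of block indices, and the
  rearranging permutation gives the coset.
\<close>

lemma block_colourings_eq_coset_colouring:
  assumes "\<beta> \<in> block_colourings bl"
  obtains \<tau> where "\<tau> permutes {..<sum_list bl}" and "coset_colouring bl (f, \<tau>) = \<beta>"
proof -
  let ?N = "sum_list bl"
  have \<beta>: "\<beta> \<in> {..<?N} \<rightarrow>\<^sub>E {..<length bl}"
    and card: "\<And>b. b < length bl \<Longrightarrow> card {a. a < ?N \<and> \<beta> a = b} = bl ! b"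
    using assms by (auto simp: block_colourings_def)
  have "mset (map \<beta> [0..<?N]) = mset (block_index bl)"
  proof (rule multiset_eqI)
    fix b
    have "count (mset (map \<beta> [0..<?N])) b = card {a. a < ?N \<and> \<beta> a = b}"
      unfolding count_mset_eq_card_nth by (intro arg_cong[where f = card]) auto
    also have "\<dots> = card {a. a < ?N \<and> block_index bl ! a = b}"
    proof (cases "b < length bl")
      case True
      then show ?thesis by (simp add: card count_block_index)
    next
      case False
      have e1: "{a. a < ?N \<and> \<beta> a = b} = {}" using \<beta> False by auto
      have e2: "{a. a < ?N \<and> block_index bl ! a = b} = {}" using block_index_less[of _ bl] False by auto
      show ?thesis by (simp only: e1 e2)
    qed
    also have "\<dots> = count (mset (block_index bl)) b"
      by (simp add: count_mset_eq_card_nth length_block_index)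
    finally show "count (mset (map \<beta> [0..<?N])) b = count (mset (block_index bl)) b" .
  qed
  then obtain \<rho> where \<rho>: "\<rho> permutes {..<length (block_index bl)}" "permute_list \<rho> (block_index bl) = map \<beta> [0..<?N]"
    by (rule mset_eq_permutation)
  note \<rho>1 = \<rho>(1)[unfolded length_block_index]
  have "block_index bl ! \<rho> a = \<beta> a" if "a < ?N" for a
    using arg_cong[OF \<rho>(2), of "\<lambda>xs. xs ! a"] that by (simp add: permute_list_def length_block_index)
  then have "coset_colouring bl (f, inv_into UNIV \<rho>) = \<beta>"
    using \<beta> \<rho>1 by (auto simp: coset_colouring_def fun_eq_iff PiE_iff extensional_def inv_inv_eq permutes_bij)
  then show ?thesis using permutes_inv[OF \<rho>1] that by blast
qed

lemma finite_carrier_wreath: "finite (carrier G) \<Longrightarrow> finite (carrier (wreath G N))"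
  unfolding wreath_simps(1) by (intro finite_cartesian_product finite_PiE finite_permutations) auto

text \<open>
  A transversal exists, so the chosen one has the defining properties.
\<close>

lemma left_transversal_wreath_young:
  assumes G: "group G" and fin: "finite (carrier G)" and N: "N = sum_list (blocks \<Lambda>)"
  defines "ts \<equiv> left_transversal (wreath G N) (wreath_young G \<Lambda>)"
  shows "distinct ts \<and> set ts \<subseteq> carrier (wreath G N) \<and>
    (\<forall>x\<in>carrier (wreath G N). \<exists>!t. t \<in> set ts \<and> x \<in> t <#\<^bsub>wreath G N\<^esub> wreath_young G \<Lambda>)"
proof -
  let ?W = "wreath G N" and ?H = "wreath_young G \<Lambda>" and ?key = "coset_colouring (blocks \<Lambda>)"
  define P where "P ts \<longleftrightarrow> distinct ts \<and> set ts \<subseteq> carrier ?W \<and>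
       (\<forall>x\<in>carrier ?W. \<exists>!t. t \<in> set ts \<and> x \<in> t <#\<^bsub>?W\<^esub> ?H)" for ts
  \<comment> \<open>One representative for each value of the colouring, that is, for each coset.\<close>
  define rep where "rep = inv_into (carrier ?W) ?key"
  have rep: "rep (?key x) \<in> carrier ?W" "?key (rep (?key x)) = ?key x" if "x \<in> carrier ?W" for x
    unfolding rep_def by (rule inv_into_into[OF imageI[OF that]], rule f_inv_into_f[OF imageI[OF that]])
  have "finite (rep ` ?key ` carrier ?W)"
    by (intro finite_imageI finite_carrier_wreath fin)
  from finite_distinct_list[OF this]
  obtain us where us: "set us = rep ` ?key ` carrier ?W" "distinct us" by (elim exE conjE)
  have "P us"
    unfolding P_def
  proof (intro conjI ballI)
    show "distinct us" by (rule us)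
    show sub: "set us \<subseteq> carrier ?W" using rep us by auto
    fix x assume x: "x \<in> carrier ?W"
    show "\<exists>!t. t \<in> set us \<and> x \<in> t <#\<^bsub>?W\<^esub> ?H"
    proof (rule ex1I[of _ "rep (?key x)"])
      show "rep (?key x) \<in> set us \<and> x \<in> rep (?key x) <#\<^bsub>?W\<^esub> ?H"
        using x rep[OF x] us(1) coset_colouring_eq_iff[OF G N x rep(1)[OF x]] by simp
    next
      fix t assume t: "t \<in> set us \<and> x \<in> t <#\<^bsub>?W\<^esub> ?H"
      then obtain z where z: "z \<in> carrier ?W" "t = rep (?key z)" using us by auto
      have "?key x = ?key t"
        using t x sub coset_colouring_eq_iff[OF G N x, of t] by auto
      then show "t = rep (?key x)" using z rep(2)[OF z(1)] by simp
    qed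
  qed
  moreover have "ts = (SOME ts. P ts)"
    unfolding ts_def left_transversal_def P_def ..
  ultimately have "P ts"
    using someI[of P us] by simp
  then show ?thesis unfolding P_def .
qed

text \<open>
  Elements with equal colourings lie in the same coset, and each distribution of positions is the colouring
  of some element, whose coset has a representative in the transversal.
\<close>

lemma bij_betw_coset_colouring:
  fixes G :: "('g, 'c) monoid_scheme"
  assumes G: "group G" and fin: "finite (carrier G)" and N: "N = sum_list (blocks \<Lambda>)"
  shows "bij_betw (coset_colouring (blocks \<Lambda>)) (set (left_transversal (wreath G N) (wreath_young G \<Lambda>)))
    (block_colourings (blocks \<Lambda>))"
proof -
  let ?W = "wreath G N" and ?H = "wreath_young G \<Lambda>" and ?key = "coset_colouring (blocks \<Lambda>)"
  define ts where "ts = left_transversal ?W ?H"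
  note T = left_transversal_wreath_young[OF assms, folded ts_def]
  have sub: "set ts \<subseteq> carrier ?W" by (rule T[THEN conjunct2, THEN conjunct1])
  have uniq: "\<exists>!t. t \<in> set ts \<and> x \<in> t <#\<^bsub>?W\<^esub> ?H" if "x \<in> carrier ?W" for x
    by (rule T[THEN conjunct2, THEN conjunct2, THEN bspec, OF that])
  have perm: "snd x permutes {..<sum_list (blocks \<Lambda>)}" if "x \<in> carrier ?W" for x
  proof -
    have "snd x \<in> {\<sigma>. \<sigma> permutes {..<N}}"
      using that unfolding wreath_simps(1) by (rule mem_Times_iff[THEN iffD1, THEN conjunct2])
    then show ?thesis unfolding N by (rule CollectD)
  qed
  show ?thesis
    unfolding ts_def[symmetric]
  proof (rule bij_betwI')
    fix t u assume t: "t \<in> set ts" and u: "u \<in> set ts"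
    have tu: "t \<in> carrier ?W" "u \<in> carrier ?W" using t u sub by auto
    show "(?key t = ?key u) = (t = u)"
    proof
      assume "?key t = ?key u"
      then have "t \<in> u <#\<^bsub>?W\<^esub> ?H" "t \<in> t <#\<^bsub>?W\<^esub> ?H"
        using tu by (simp_all add: coset_colouring_eq_iff[OF G N])
      then show "t = u" using ex1E[OF uniq[OF tu(1)]] t u by metis
    qed simp
  next
    fix t assume "t \<in> set ts"
    then show "?key t \<in> block_colourings (blocks \<Lambda>)"
      using sub by (intro coset_colouring_in_block_colourings perm) (rule subsetD)
  next
    fix \<beta> assume "\<beta> \<in> block_colourings (blocks \<Lambda>)"
    then obtain \<tau> where \<tau>: "\<tau> permutes {..<sum_list (blocks \<Lambda>)}"
      and key: "coset_colouring (blocks \<Lambda>) (\<lambda>a\<in>{..<N}. \<one>\<^bsub>G\<^esub>, \<tau>) = \<beta>"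
      by (rule block_colourings_eq_coset_colouring)
    define x where "x = ((\<lambda>a\<in>{..<N}. \<one>\<^bsub>G\<^esub>), \<tau>)"
    have x: "x \<in> carrier ?W"
      using \<tau>[folded N] monoid.one_closed[OF group.is_monoid[OF G]] unfolding x_def wreath_simps(1) by simp
    obtain t where t: "t \<in> set ts" "x \<in> t <#\<^bsub>?W\<^esub> ?H"
      using ex1_implies_ex[OF uniq[OF x]] by blast
    then have "?key x = ?key t" using sub coset_colouring_eq_iff[OF G N x, of t] by auto
    then have "\<beta> = ?key t" using key by (simp add: x_def)
    with t show "\<exists>t\<in>set ts. \<beta> = ?key t" by blast
  qed
qed

section \<open>The character of a permutation module as a sum over colourings\<close>

lemma foldr_mult_telescope:
  assumes "group G"
    and "\<And>r. r \<le> l \<Longrightarrow> u r \<in> carrier G" and "\<And>r. r < l \<Longrightarrow> v r \<in> carrier G"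
  shows "foldr (\<lambda>r y. (inv\<^bsub>G\<^esub> u r \<otimes>\<^bsub>G\<^esub> v r \<otimes>\<^bsub>G\<^esub> u (Suc r)) \<otimes>\<^bsub>G\<^esub> y) [0..<l] \<one>\<^bsub>G\<^esub> =
    inv\<^bsub>G\<^esub> u 0 \<otimes>\<^bsub>G\<^esub> foldr (\<lambda>r y. v r \<otimes>\<^bsub>G\<^esub> y) [0..<l] \<one>\<^bsub>G\<^esub> \<otimes>\<^bsub>G\<^esub> u l"
  using assms(2,3)
proof (induction l arbitrary: u v)
  case 0
  interpret group G by fact
  show ?case using 0 by simp
next
  case (Suc l)
  interpret group G by fact
  have upt: "[0..<Suc l] = 0 # map Suc [0..<l]"
    by (simp add: upt_conv_Cons map_Suc_upt del: upt_Suc)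
  define X where "X = foldr (\<lambda>r y. v (Suc r) \<otimes>\<^bsub>G\<^esub> y) [0..<l] \<one>\<^bsub>G\<^esub>"
  have X: "X \<in> carrier G"
    unfolding X_def using Suc.prems(2) by (intro foldr_mult_closed[OF assms(1)]) auto
  have u: "u 0 \<in> carrier G" "u (Suc 0) \<in> carrier G" "u (Suc l) \<in> carrier G" and v: "v 0 \<in> carrier G"
    using Suc.prems by auto
  have IH: "foldr (\<lambda>r y. (inv\<^bsub>G\<^esub> u (Suc r) \<otimes>\<^bsub>G\<^esub> v (Suc r) \<otimes>\<^bsub>G\<^esub> u (Suc (Suc r))) \<otimes>\<^bsub>G\<^esub> y) [0..<l] \<one>\<^bsub>G\<^esub> =
      inv\<^bsub>G\<^esub> u (Suc 0) \<otimes>\<^bsub>G\<^esub> X \<otimes>\<^bsub>G\<^esub> u (Suc l)"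
    unfolding X_def using Suc.prems by (intro Suc.IH[of "\<lambda>r. u (Suc r)" "\<lambda>r. v (Suc r)"]) auto
  have "u (Suc 0) \<otimes>\<^bsub>G\<^esub> (inv\<^bsub>G\<^esub> u (Suc 0) \<otimes>\<^bsub>G\<^esub> (X \<otimes>\<^bsub>G\<^esub> u (Suc l))) = X \<otimes>\<^bsub>G\<^esub> u (Suc l)"
    using u X by (simp flip: m_assoc)
  then have "(inv\<^bsub>G\<^esub> u 0 \<otimes>\<^bsub>G\<^esub> v 0 \<otimes>\<^bsub>G\<^esub> u (Suc 0)) \<otimes>\<^bsub>G\<^esub> (inv\<^bsub>G\<^esub> u (Suc 0) \<otimes>\<^bsub>G\<^esub> X \<otimes>\<^bsub>G\<^esub> u (Suc l)) =
      inv\<^bsub>G\<^esub> u 0 \<otimes>\<^bsub>G\<^esub> (v 0 \<otimes>\<^bsub>G\<^esub> X) \<otimes>\<^bsub>G\<^esub> u (Suc l)"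
    using u v X by (simp add: m_assoc)
  then show ?case
    unfolding upt by (simp add: foldr_map comp_def IH X_def)
qed

text \<open>
  Conjugation transports the cycles by \<open>\<tau>\<^sup>-\<^sup>1\<close>, and the factors coming from \<open>g\<close> telescope around the cycle, so
  the cycle product is conjugated by the value of \<open>g\<close> at the starting point.
\<close>

lemma cycle_product_conjugate:
  assumes G: "group G" and x: "(f, \<sigma>) \<in> carrier (wreath G N)" and t: "(g, \<tau>) \<in> carrier (wreath G N)"
    and b: "b < N"
  defines "\<rho> \<equiv> inv_into UNIV \<tau> \<circ> \<sigma> \<circ> \<tau>"
    and "h \<equiv> (\<lambda>a\<in>{..<N}. inv\<^bsub>G\<^esub> g (\<tau> a) \<otimes>\<^bsub>G\<^esub> f (\<tau> a) \<otimes>\<^bsub>G\<^esub> g (inv_into UNIV \<sigma> (\<tau> a)))"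
  shows "Orbits.orbit \<rho> (inv_into UNIV \<tau> b) = inv_into UNIV \<tau> ` Orbits.orbit \<sigma> b"
    and "cycle_product G (h, \<rho>) (inv_into UNIV \<tau> b) = inv\<^bsub>G\<^esub> g b \<otimes>\<^bsub>G\<^esub> cycle_product G (f, \<sigma>) b \<otimes>\<^bsub>G\<^esub> g b"
proof -
  define \<tau>' where "\<tau>' = inv_into UNIV \<tau>"
  define s where "s = inv_into UNIV \<sigma>"
  have \<sigma>: "\<sigma> permutes {..<N}" and \<tau>: "\<tau> permutes {..<N}"
    and f: "\<And>a. a < N \<Longrightarrow> f a \<in> carrier G" and g: "\<And>a. a < N \<Longrightarrow> g a \<in> carrier G"
    using x t by (auto simp: wreath_simps)
  have perm: "permutation \<sigma>" using \<sigma> by (auto simp: permutation_permutes)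
  have s: "s permutes {..<N}" and \<tau>'p: "\<tau>' permutes {..<N}"
    unfolding s_def \<tau>'_def using \<sigma> \<tau> by (auto intro: permutes_inv)
  have \<tau>\<tau>': "\<tau> (\<tau>' a) = a" for a
    unfolding \<tau>'_def by (rule permutes_inverses(1)[OF \<tau>])
  have orb: "Orbits.orbit \<rho> (\<tau>' b) = \<tau>' ` Orbits.orbit \<sigma> b"
    by (rule orbit_inverse[symmetric, OF permutation_self_in_orbit[OF perm]])
      (simp add: \<rho>_def \<tau>\<tau>' flip: \<tau>'_def)
  then show "Orbits.orbit \<rho> (inv_into UNIV \<tau> b) = inv_into UNIV \<tau> ` Orbits.orbit \<sigma> b"
    by (simp only: \<tau>'_def)
  have inv_\<rho>: "inv_into UNIV \<rho> = \<tau>' \<circ> s \<circ> \<tau>"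
  proof (rule inv_unique_comp)
    show "\<rho> \<circ> (\<tau>' \<circ> s \<circ> \<tau>) = id"
      using permutes_inverses[OF \<sigma>] permutes_inverses[OF \<tau>] by (auto simp: \<rho>_def \<tau>'_def s_def)
    show "\<tau>' \<circ> s \<circ> \<tau> \<circ> \<rho> = id"
      using permutes_inverses[OF \<sigma>] permutes_inverses[OF \<tau>] by (auto simp: \<rho>_def \<tau>'_def s_def)
  qed
  have pow: "(inv_into UNIV \<rho> ^^ r) (\<tau>' b) = \<tau>' ((s ^^ r) b)" for r
    by (induction r) (simp_all add: inv_\<rho> \<tau>\<tau>')
  have sN: "(s ^^ r) b < N" for r
    using permutes_lessThan[OF s] b by (induction r) auto
  define l where "l = card (Orbits.orbit \<sigma> b)"
  have "inj \<tau>'" using \<tau>'p by (rule permutes_inj)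
  then have l: "card (Orbits.orbit \<rho> (\<tau>' b)) = l"
    unfolding orb l_def by (intro card_image) (auto intro: inj_on_subset)
  have s_l: "(s ^^ l) b = b"
    using funpow_bij_betw_orbit(2)[of s b] permutation_inverse[OF perm] orbit_inv_eq[OF perm, of b]
    unfolding l_def s_def by simp
  have h: "h (\<tau>' c) = inv\<^bsub>G\<^esub> g c \<otimes>\<^bsub>G\<^esub> f c \<otimes>\<^bsub>G\<^esub> g (s c)" if "c < N" for c
    using permutes_lessThan[OF \<tau>'p that] unfolding h_def s_def[symmetric] by (simp add: \<tau>\<tau>')
  have "cycle_product G (h, \<rho>) (\<tau>' b) =
      foldr (\<lambda>r y. (inv\<^bsub>G\<^esub> g ((s ^^ r) b) \<otimes>\<^bsub>G\<^esub> f ((s ^^ r) b) \<otimes>\<^bsub>G\<^esub> g ((s ^^ Suc r) b)) \<otimes>\<^bsub>G\<^esub> y) [0..<l] \<one>\<^bsub>G\<^esub>"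
    unfolding cycle_product_def prod.case l pow h[OF sN] by simp
  also have "\<dots> = inv\<^bsub>G\<^esub> g ((s ^^ 0) b) \<otimes>\<^bsub>G\<^esub> foldr (\<lambda>r y. f ((s ^^ r) b) \<otimes>\<^bsub>G\<^esub> y) [0..<l] \<one>\<^bsub>G\<^esub> \<otimes>\<^bsub>G\<^esub> g ((s ^^ l) b)"
    by (rule foldr_mult_telescope[OF G]) (use f g sN in auto)
  also have "\<dots> = inv\<^bsub>G\<^esub> g b \<otimes>\<^bsub>G\<^esub> cycle_product G (f, \<sigma>) b \<otimes>\<^bsub>G\<^esub> g b"
    unfolding s_l cycle_product_def prod.case l_def[symmetric] s_def[symmetric] by simp
  finally show "cycle_product G (h, \<rho>) (inv_into UNIV \<tau> b) = inv\<^bsub>G\<^esub> g b \<otimes>\<^bsub>G\<^esub> cycle_product G (f, \<sigma>) b \<otimes>\<^bsub>G\<^esub> g b"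
    unfolding \<tau>'_def .
qed

lemma mat_trace_conjugate':
  assumes "representation G n \<rho>" and "group G" and "g \<in> carrier G" and "h \<in> carrier G"
  shows "mat_trace (\<rho> (inv\<^bsub>G\<^esub> h \<otimes>\<^bsub>G\<^esub> g \<otimes>\<^bsub>G\<^esub> h)) = mat_trace (\<rho> g)"
  using mat_trace_conjugate[OF assms(1,2,3), of "inv\<^bsub>G\<^esub> h"] assms by (simp add: group.inv_inv)

text \<open>
  Conjugation by \<open>t\<close> moves the cycles, and with them the colours, as described by the colouring of the coset
  of \<open>t\<close>; it also conjugates the cycle products, which the characters do not notice.
\<close>

lemma mat_trace_tensor_rep_conjugate:
  assumes G: "group G" and N: "N = sum_list (blocks \<Lambda>)"
    and colours: "colours \<Lambda> = map bcol (block_index (blocks \<Lambda>))"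
    and V: "\<And>b. b < length (blocks \<Lambda>) \<Longrightarrow> representation G (d (bcol b)) (V (bcol b))"
    and x: "(f, \<sigma>) \<in> carrier (wreath G N)" and t: "t \<in> carrier (wreath G N)"
    and invar: "\<And>a. a < N \<Longrightarrow> coset_colouring (blocks \<Lambda>) t (\<sigma> a) = coset_colouring (blocks \<Lambda>) t a"
    and pt: "\<And>c. c \<in> Orbits.orbit \<sigma> ` {..<N} \<Longrightarrow> pt c \<in> c"
  shows "mat_trace (tensor_rep d V (colours \<Lambda>) (inv\<^bsub>wreath G N\<^esub> t \<otimes>\<^bsub>wreath G N\<^esub> (f, \<sigma>) \<otimes>\<^bsub>wreath G N\<^esub> t)) =
    (\<Prod>c\<in>Orbits.orbit \<sigma> ` {..<N}.
      mat_trace (V (bcol (coset_colouring (blocks \<Lambda>) t (pt c))) (cycle_product G (f, \<sigma>) (pt c))))"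
proof -
  \<comment> \<open>The colour of position \<open>\<tau>\<^sup>-\<^sup>1 a\<close> is that of block \<open>\<beta> a\<close>, so on cycles transported by \<open>\<tau>\<^sup>-\<^sup>1\<close> the colours can be read off from \<open>\<beta>\<close>.\<close>
  define \<beta> where "\<beta> = coset_colouring (blocks \<Lambda>) t"
  obtain g \<tau> where t': "t = (g, \<tau>)" by (metis surj_pair)
  note t2 = t[unfolded t']
  have \<sigma>: "\<sigma> permutes {..<N}" and \<tau>: "\<tau> permutes {..<N}"
    and f: "\<And>a. a < N \<Longrightarrow> f a \<in> carrier G" and g: "\<And>a. a < N \<Longrightarrow> g a \<in> carrier G"
    using x t2 by (auto simp: wreath_simps)
  define \<tau>' where "\<tau>' = inv_into UNIV \<tau>"
  define \<rho> where "\<rho> = \<tau>' \<circ> \<sigma> \<circ> \<tau>"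
  define h where "h = (\<lambda>a\<in>{..<N}. inv\<^bsub>G\<^esub> g (\<tau> a) \<otimes>\<^bsub>G\<^esub> f (\<tau> a) \<otimes>\<^bsub>G\<^esub> g (inv_into UNIV \<sigma> (\<tau> a)))"
  note conj = cycle_product_conjugate[OF G x t2, folded \<tau>'_def, folded \<rho>_def h_def]
  have \<tau>': "\<tau>' permutes {..<N}" unfolding \<tau>'_def using \<tau> by (rule permutes_inv)
  have \<rho>: "\<rho> permutes {..<N}"
    unfolding \<rho>_def by (intro permutes_compose \<sigma> \<tau> \<tau>')
  have len: "length (colours \<Lambda>) = N" by (simp add: colours length_block_index N)
  have \<beta>: "\<beta> a = block_index (blocks \<Lambda>) ! \<tau>' a" if "a < N" for a
    using that by (simp add: \<beta>_def coset_colouring_def t' \<tau>'_def N)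
  have bcol: "colours \<Lambda> ! a = bcol (block_index (blocks \<Lambda>) ! a)" if "a < N" for a
    using that by (simp add: colours length_block_index N)
  have bcol_inv: "colours \<Lambda> ! \<tau>' a = bcol (\<beta> a)" if "a < N" for a
    using bcol[OF permutes_lessThan[OF \<tau>' that]] \<beta>[OF that] by simp
  have \<tau>\<tau>': "\<tau> (\<tau>' a) = a" for a
    unfolding \<tau>'_def by (rule permutes_inverses(1)[OF \<tau>])
  have \<tau>'\<tau>: "\<tau>' (\<tau> a) = a" for a
    unfolding \<tau>'_def by (rule permutes_inverses(2)[OF \<tau>])
  have inj: "inj ((`) \<tau>')"
    by (rule injI) (simp add: inj_image_eq_iff[OF permutes_inj[OF \<tau>']])
  have O: "Orbits.orbit \<rho> ` {..<N} = (`) \<tau>' ` (Orbits.orbit \<sigma> ` {..<N})"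
  proof -
    have "{..<N} = \<tau>' ` {..<N}" using permutes_image[OF \<tau>'] by simp
    then have "Orbits.orbit \<rho> ` {..<N} = (\<lambda>b. Orbits.orbit \<rho> (\<tau>' b)) ` {..<N}"
      by (metis image_image)
    also have "\<dots> = (\<lambda>b. \<tau>' ` Orbits.orbit \<sigma> b) ` {..<N}"
      by (intro image_cong refl conj(1)) simp
    finally show ?thesis by (simp only: image_image)
  qed
  define pt' where "pt' c = \<tau>' (pt (\<tau> ` c))" for c
  have pt'_image: "pt' (\<tau>' ` c) = \<tau>' (pt c)" for c
    unfolding pt'_def by (simp add: image_image \<tau>\<tau>')
  have ptN: "pt c < N" if "c \<in> Orbits.orbit \<sigma> ` {..<N}" for c
    using pt[OF that] permutes_orbits(1)[OF \<sigma>] that by blast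
  have "mat_trace (tensor_rep d V (colours \<Lambda>) (h, \<rho>)) =
      (\<Prod>c\<in>Orbits.orbit \<rho> ` {..<length (colours \<Lambda>)}. mat_trace (V (colours \<Lambda> ! pt' c) (cycle_product G (h, \<rho>) (pt' c))))"
  proof (rule mat_trace_tensor_rep[OF G])
    show "\<rho> permutes {..<length (colours \<Lambda>)}" unfolding len by (rule \<rho>)
    fix a assume "a < length (colours \<Lambda>)"
    then have a: "a < N" by (simp only: len)
    have \<tau>a: "\<tau> a < N" by (rule permutes_lessThan[OF \<tau> a])
    have "colours \<Lambda> ! \<rho> a = bcol (\<beta> (\<sigma> (\<tau> a)))"
      unfolding \<rho>_def comp_def by (rule bcol_inv[OF permutes_lessThan[OF \<sigma> \<tau>a]])
    also have "\<dots> = bcol (\<beta> (\<tau> a))" using invar[OF \<tau>a] by (simp only: \<beta>_def)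
    also have "\<dots> = colours \<Lambda> ! a" using bcol_inv[OF \<tau>a] by (simp only: \<tau>'\<tau>)
    finally show "colours \<Lambda> ! \<rho> a = colours \<Lambda> ! a" .
    show "h a \<in> carrier G"
      using a \<tau>a permutes_inv_lessThan[OF \<sigma> \<tau>a] f g G
      by (simp add: h_def group.is_monoid monoid.m_closed group.inv_closed)
    show "representation G (d (colours \<Lambda> ! a)) (V (colours \<Lambda> ! a))"
      unfolding bcol[OF a] using a block_index_less[of a "blocks \<Lambda>"] V by (simp add: N)
  next
    fix c assume "c \<in> Orbits.orbit \<rho> ` {..<length (colours \<Lambda>)}"
    then obtain c' where c': "c' \<in> Orbits.orbit \<sigma> ` {..<N}" "c = \<tau>' ` c'"
      unfolding len O by blast
    show "pt' c \<in> c" unfolding c'(2) pt'_image using pt[OF c'(1)] by (rule imageI)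
  qed
  also have "\<dots> = (\<Prod>c\<in>Orbits.orbit \<sigma> ` {..<N}.
      mat_trace (V (colours \<Lambda> ! \<tau>' (pt c)) (cycle_product G (h, \<rho>) (\<tau>' (pt c)))))"
    unfolding len O by (subst prod.reindex) (use inj in \<open>auto simp: pt'_image intro: inj_on_subset\<close>)
  also have "\<dots> = (\<Prod>c\<in>Orbits.orbit \<sigma> ` {..<N}. mat_trace (V (bcol (\<beta> (pt c))) (cycle_product G (f, \<sigma>) (pt c))))"
  proof (intro prod.cong refl)
    fix c assume "c \<in> Orbits.orbit \<sigma> ` {..<N}"
    then have c: "pt c < N" by (rule ptN)
    have "\<beta> (pt c) < length (blocks \<Lambda>)"
      unfolding \<beta>[OF c] using permutes_lessThan[OF \<tau>' c] block_index_less[of _ "blocks \<Lambda>"] by (simp add: N)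
    then show "mat_trace (V (colours \<Lambda> ! \<tau>' (pt c)) (cycle_product G (h, \<rho>) (\<tau>' (pt c)))) =
        mat_trace (V (bcol (\<beta> (pt c))) (cycle_product G (f, \<sigma>) (pt c)))"
      unfolding bcol_inv[OF c] conj(2)[OF c]
      by (intro mat_trace_conjugate'[OF V G] cycle_product_closed[OF G \<sigma>] c f g) auto
  qed
  finally have main: "mat_trace (tensor_rep d V (colours \<Lambda>) (h, \<rho>)) =
      (\<Prod>c\<in>Orbits.orbit \<sigma> ` {..<N}. mat_trace (V (bcol (\<beta> (pt c))) (cycle_product G (f, \<sigma>) (pt c))))" .
  have "inv\<^bsub>wreath G N\<^esub> t \<otimes>\<^bsub>wreath G N\<^esub> (f, \<sigma>) \<otimes>\<^bsub>wreath G N\<^esub> t = (h, \<rho>)"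
    unfolding t' wreath_conjugate[OF G x t2] h_def \<rho>_def \<tau>'_def ..
  with main show ?thesis unfolding \<beta>_def by simp
qed

text \<open>
  The element fixes the coset of \<open>t\<close> iff it preserves the colouring that the coset stands for.
\<close>

lemma conjugate_in_wreath_young:
  assumes G: "group G" and N: "N = sum_list (blocks \<Lambda>)"
    and x: "(f, \<sigma>) \<in> carrier (wreath G N)" and t: "t \<in> carrier (wreath G N)"
  shows "inv\<^bsub>wreath G N\<^esub> t \<otimes>\<^bsub>wreath G N\<^esub> (f, \<sigma>) \<otimes>\<^bsub>wreath G N\<^esub> t \<in> wreath_young G \<Lambda> \<longleftrightarrow>
    (\<forall>a<N. coset_colouring (blocks \<Lambda>) t (\<sigma> a) = coset_colouring (blocks \<Lambda>) t a)"
proof -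
  interpret W: group "wreath G N" by (rule group_wreath[OF G])
  define \<beta> where "\<beta> = coset_colouring (blocks \<Lambda>) t"
  obtain g \<tau> where t': "t = (g, \<tau>)" by (metis surj_pair)
  have \<sigma>: "\<sigma> permutes {..<N}" and \<tau>: "\<tau> permutes {..<N}"
    using x t by (auto simp: t' wreath_simps)
  define \<tau>' where "\<tau>' = inv_into UNIV \<tau>"
  define y where "y = inv\<^bsub>wreath G N\<^esub> t \<otimes>\<^bsub>wreath G N\<^esub> (f, \<sigma>) \<otimes>\<^bsub>wreath G N\<^esub> t"
  have "y \<in> carrier (wreath G N)" unfolding y_def using x t by simp
  then have y: "fst y \<in> {..<N} \<rightarrow>\<^sub>E carrier G" "snd y permutes {..<N}"
    by (auto simp: wreath_simps(1) mem_Times_iff)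
  have snd_y: "snd y = \<tau>' \<circ> \<sigma> \<circ> \<tau>"
    unfolding y_def t' wreath_conjugate[OF G x t[unfolded t']] \<tau>'_def by simp
  have \<beta>: "block_index (blocks \<Lambda>) ! \<tau>' a = \<beta> a" if "a < N" for a
    using that by (simp add: \<beta>_def coset_colouring_def t' \<tau>'_def N)
  have \<tau>\<tau>': "\<tau> (\<tau>' a) = a" and \<tau>'\<tau>: "\<tau>' (\<tau> a) = a" for a
    unfolding \<tau>'_def using permutes_inverses[OF \<tau>] by auto
  have \<tau>': "\<tau>' permutes {..<N}" unfolding \<tau>'_def using \<tau> by (rule permutes_inv)
  have "y \<in> wreath_young G \<Lambda> \<longleftrightarrow> (\<forall>a<N. block_index (blocks \<Lambda>) ! snd y a = block_index (blocks \<Lambda>) ! a)"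
    using y by (simp add: wreath_young_def young_subgroup_def mem_Times_iff flip: N)
  also have "\<dots> \<longleftrightarrow> (\<forall>a<N. \<beta> (\<sigma> a) = \<beta> a)"
  proof (intro iffI allI impI)
    fix a assume *: "\<forall>a<N. block_index (blocks \<Lambda>) ! snd y a = block_index (blocks \<Lambda>) ! a" and a: "a < N"
    have "\<beta> (\<sigma> a) = block_index (blocks \<Lambda>) ! snd y (\<tau>' a)"
      by (simp add: snd_y \<tau>\<tau>' \<beta> permutes_lessThan[OF \<sigma> a])
    also have "\<dots> = block_index (blocks \<Lambda>) ! \<tau>' a"
      using * permutes_lessThan[OF \<tau>' a] by blast
    finally show "\<beta> (\<sigma> a) = \<beta> a" by (simp add: \<beta> a)
  next
    fix a assume *: "\<forall>a<N. \<beta> (\<sigma> a) = \<beta> a" and a: "a < N"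
    have \<tau>a: "\<tau> a < N" by (rule permutes_lessThan[OF \<tau> a])
    have "block_index (blocks \<Lambda>) ! snd y a = \<beta> (\<sigma> (\<tau> a))"
      by (simp add: snd_y \<beta> permutes_lessThan[OF \<sigma> \<tau>a])
    also have "\<dots> = \<beta> (\<tau> a)" using * \<tau>a by blast
    also have "\<dots> = block_index (blocks \<Lambda>) ! a" using \<beta>[OF \<tau>a] by (simp add: \<tau>'\<tau>)
    finally show "block_index (blocks \<Lambda>) ! snd y a = block_index (blocks \<Lambda>) ! a" .
  qed
  finally show ?thesis unfolding y_def \<beta>_def .
qed

text \<open>
  The character of an induced representation sums over the fixed cosets; they correspond to the invariant
  colourings, and the summand depends on the coset only through its colouring.
\<close>

lemma mat_trace_perm_module:
  assumes G: "group G" and fin: "finite (carrier G)" and N: "N = sum_list (blocks \<Lambda>)"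
    and colours: "colours \<Lambda> = map bcol (block_index (blocks \<Lambda>))"
    and V: "\<And>b. b < length (blocks \<Lambda>) \<Longrightarrow> representation G (d (bcol b)) (V (bcol b))"
    and x: "(f, \<sigma>) \<in> carrier (wreath G N)"
    and pt: "\<And>c. c \<in> Orbits.orbit \<sigma> ` {..<N} \<Longrightarrow> pt c \<in> c"
  shows "mat_trace (perm_module G N d V \<Lambda> (f, \<sigma>)) =
    (\<Sum>\<beta> | \<beta> \<in> block_colourings (blocks \<Lambda>) \<and> (\<forall>a<N. \<beta> (\<sigma> a) = \<beta> a).
      \<Prod>c\<in>Orbits.orbit \<sigma> ` {..<N}. mat_trace (V (bcol (\<beta> (pt c))) (cycle_product G (f, \<sigma>) (pt c))))"
proof -
  let ?W = "wreath G N" and ?H = "wreath_young G \<Lambda>" and ?key = "coset_colouring (blocks \<Lambda>)"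
  define F where "F \<beta> = (\<Prod>c\<in>Orbits.orbit \<sigma> ` {..<N}. mat_trace (V (bcol (\<beta> (pt c))) (cycle_product G (f, \<sigma>) (pt c))))" for \<beta>
  define ts where "ts = set (left_transversal ?W ?H)"
  define y where "y t = inv\<^bsub>?W\<^esub> t \<otimes>\<^bsub>?W\<^esub> (f, \<sigma>) \<otimes>\<^bsub>?W\<^esub> t" for t
  define invariant where "invariant \<beta> \<longleftrightarrow> (\<forall>a<N. \<beta> (\<sigma> a) = \<beta> a)" for \<beta> :: "nat \<Rightarrow> nat"
  note T = left_transversal_wreath_young[OF G fin N]
  note dist = T[THEN conjunct1]
  have sub: "t \<in> carrier ?W" if "t \<in> ts" for t
    using T[THEN conjunct2, THEN conjunct1] that unfolding ts_def by (rule subsetD)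
  have tr: "(\<Sum>i<length (tensor_basis d (colours \<Lambda>)). tensor_rep d V (colours \<Lambda>) z $$ (i, i)) = mat_trace (tensor_rep d V (colours \<Lambda>) z)" for z
    by (cases z) (simp add: mat_trace_def tensor_rep_def Let_def)
  have "mat_trace (perm_module G N d V \<Lambda> (f, \<sigma>)) =
      (\<Sum>t | t \<in> ts \<and> y t \<in> ?H. mat_trace (tensor_rep d V (colours \<Lambda>) (y t)))"
    unfolding perm_module_def mat_trace_induced_rep[OF dist] tr y_def ts_def ..
  also have "\<dots> = (\<Sum>t | t \<in> ts \<and> invariant (?key t). F (?key t))"
  proof (intro sum.cong)
    have iff: "y t \<in> ?H \<longleftrightarrow> invariant (?key t)" if "t \<in> ts" for t
      unfolding y_def invariant_def by (rule conjugate_in_wreath_young[OF G N x sub[OF that]])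
    then show "{t. t \<in> ts \<and> y t \<in> ?H} = {t. t \<in> ts \<and> invariant (?key t)}" by blast
    fix t assume "t \<in> {t. t \<in> ts \<and> invariant (?key t)}"
    then have t: "t \<in> carrier ?W" and key: "\<And>a. a < N \<Longrightarrow> ?key t (\<sigma> a) = ?key t a"
      by (simp_all add: invariant_def sub)
    show "mat_trace (tensor_rep d V (colours \<Lambda>) (y t)) = F (?key t)"
      unfolding y_def F_def
      by (rule mat_trace_tensor_rep_conjugate[where bcol = bcol])
        (simp_all add: G N[symmetric] colours V x t key pt)
  qed
  also have "\<dots> = (\<Sum>\<beta> | \<beta> \<in> block_colourings (blocks \<Lambda>) \<and> invariant \<beta>. F \<beta>)"
  proof (rule sum.reindex_bij_betw)
    have bij: "bij_betw ?key ts (block_colourings (blocks \<Lambda>))"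
      unfolding ts_def by (rule bij_betw_coset_colouring[OF G fin N])
    show "bij_betw ?key {t. t \<in> ts \<and> invariant (?key t)} {\<beta>. \<beta> \<in> block_colourings (blocks \<Lambda>) \<and> invariant \<beta>}"
      unfolding bij_betw_def
    proof
      show "inj_on ?key {t. t \<in> ts \<and> invariant (?key t)}"
        using bij_betw_imp_inj_on[OF bij] by (rule inj_on_subset) auto
      show "?key ` {t. t \<in> ts \<and> invariant (?key t)} = {\<beta>. \<beta> \<in> block_colourings (blocks \<Lambda>) \<and> invariant \<beta>}"
        unfolding bij_betw_imp_surj_on[OF bij, symmetric] by blast
    qed
  qed
  finally show ?thesis unfolding F_def invariant_def .
qed

section \<open>Invariant colourings, cycles and conjugacy classes\<close>

text \<open>
  A colouring is invariant iff it is constant on cycles, so invariant colourings of positions are colourings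
  of cycles, where a cycle counts as many times as it has elements.
\<close>

lemma sum_invariant_colourings:
  fixes F :: "(nat set \<Rightarrow> nat) \<Rightarrow> 'a :: comm_monoid_add"
  assumes \<sigma>: "\<sigma> permutes {..<N}" and N: "N = sum_list bl"
    and pt: "\<And>c. c \<in> Orbits.orbit \<sigma> ` {..<N} \<Longrightarrow> pt c \<in> c"
  shows "(\<Sum>\<beta> | \<beta> \<in> block_colourings bl \<and> (\<forall>a<N. \<beta> (\<sigma> a) = \<beta> a). F (\<lambda>c\<in>Orbits.orbit \<sigma> ` {..<N}. \<beta> (pt c))) =
    (\<Sum>\<gamma> | \<gamma> \<in> (Orbits.orbit \<sigma> ` {..<N}) \<rightarrow>\<^sub>E {..<length bl} \<and>
        (\<forall>b<length bl. (\<Sum>c | c \<in> Orbits.orbit \<sigma> ` {..<N} \<and> \<gamma> c = b. card c) = bl ! b). F \<gamma>)"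
proof -
  define P where "P = Orbits.orbit \<sigma> ` {..<N}"
  define n where "n = length bl"
  \<comment> \<open>Restriction to the starting points of the cycles and extension along the cycles are inverse to each other.\<close>
  define restr where "restr \<beta> = (\<lambda>c\<in>P. \<beta> (pt c))" for \<beta> :: "nat \<Rightarrow> nat"
  define ext where "ext \<gamma> = (\<lambda>a\<in>{..<N}. \<gamma> (Orbits.orbit \<sigma> a))" for \<gamma> :: "nat set \<Rightarrow> nat"
  note orbits = permutes_orbits[OF \<sigma>, folded P_def]
  have perm: "permutation \<sigma>" using \<sigma> by (auto simp: permutation_permutes)
  have orbP: "Orbits.orbit \<sigma> a \<in> P" if "a < N" for a
    using that by (simp add: P_def)
  have self: "a \<in> Orbits.orbit \<sigma> a" for a
    by (rule permutation_self_in_orbit[OF perm])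
  have pt: "pt c \<in> c" if "c \<in> P" for c
    using pt that by (simp add: P_def)
  have ptN: "pt c < N" if "c \<in> P" for c
    using pt[OF that] orbits(1) that by blast
  have orb_pt: "Orbits.orbit \<sigma> (pt c) = c" if "c \<in> P" for c
    using orbits(3)[OF that pt[OF that]] by simp
  have finP: "finite P" by (simp add: P_def)
  have fin: "finite c" if "c \<in> P" for c
    using orbits(1) that by (metis Union_upper finite_lessThan finite_subset)
  have const: "\<beta> b = \<beta> a" if inv: "\<forall>a<N. \<beta> (\<sigma> a) = \<beta> a" and a: "a < N" and b: "b \<in> Orbits.orbit \<sigma> a"
    for \<beta> :: "nat \<Rightarrow> nat" and a b
    using b
  proof induction
    case base
    then show ?case using inv a by blast
  next
    case (step b)
    then have "b < N" using permutes_orbit_subset[OF \<sigma>, of a] a by auto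
    then show ?case using inv step.IH by simp
  qed
  have card: "card {a. a < N \<and> ext \<gamma> a = b} = (\<Sum>c | c \<in> P \<and> \<gamma> c = b. card c)" for \<gamma> b
  proof -
    have "{a. a < N \<and> ext \<gamma> a = b} = \<Union>{c. c \<in> P \<and> \<gamma> c = b}"
    proof (intro equalityI subsetI)
      fix a assume "a \<in> {a. a < N \<and> ext \<gamma> a = b}"
      then show "a \<in> \<Union>{c. c \<in> P \<and> \<gamma> c = b}"
        using self[of a] orbP[of a] by (auto simp: ext_def)
    next
      fix a assume "a \<in> \<Union>{c. c \<in> P \<and> \<gamma> c = b}"
      then obtain c where c: "c \<in> P" "\<gamma> c = b" "a \<in> c" by blast
      then have "a < N" using orbits(1) by blast
      then show "a \<in> {a. a < N \<and> ext \<gamma> a = b}"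
        using c orbits(3)[OF c(1,3)] by (simp add: ext_def)
    qed
    also have "card \<dots> = (\<Sum>c | c \<in> P \<and> \<gamma> c = b. card c)"
    proof (rule card_Union_disjoint)
      show "pairwise disjnt {c. c \<in> P \<and> \<gamma> c = b}"
        using orbits(2) by (rule pairwise_subset) auto
    qed (use fin in auto)
    finally show ?thesis .
  qed
  have ext_restr: "ext (restr \<beta>) = \<beta>"
    if "\<beta> \<in> block_colourings bl" and inv: "\<forall>a<N. \<beta> (\<sigma> a) = \<beta> a" for \<beta>
  proof
    fix a
    have ext: "\<beta> \<in> {..<N} \<rightarrow>\<^sub>E {..<n}" using that(1) by (simp add: block_colourings_def N n_def)
    show "ext (restr \<beta>) a = \<beta> a"
    proof (cases "a < N")
      case True
      then show ?thesis
        using const[OF inv True pt[OF orbP[OF True]]] orbP[OF True] by (simp add: ext_def restr_def)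
    next
      case False
      then show ?thesis using PiE_arb[OF ext, of a] by (simp add: ext_def)
    qed
  qed
  have restr_ext: "restr (ext \<gamma>) = \<gamma>" if "\<gamma> \<in> P \<rightarrow>\<^sub>E {..<n}" for \<gamma>
  proof
    fix c
    show "restr (ext \<gamma>) c = \<gamma> c"
      using PiE_arb[OF that, of c] by (cases "c \<in> P") (simp_all add: ext_def restr_def ptN orb_pt)
  qed
  have "(\<Sum>\<beta> | \<beta> \<in> block_colourings bl \<and> (\<forall>a<N. \<beta> (\<sigma> a) = \<beta> a). F (restr \<beta>)) =
    (\<Sum>\<gamma> | \<gamma> \<in> P \<rightarrow>\<^sub>E {..<n} \<and> (\<forall>b<n. (\<Sum>c | c \<in> P \<and> \<gamma> c = b. card c) = bl ! b). F \<gamma>)"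
  proof (rule sum.reindex_bij_witness[where i = ext and j = restr])
    fix \<beta> assume "\<beta> \<in> {\<beta>. \<beta> \<in> block_colourings bl \<and> (\<forall>a<N. \<beta> (\<sigma> a) = \<beta> a)}"
    then have \<beta>: "\<beta> \<in> block_colourings bl" and inv: "\<forall>a<N. \<beta> (\<sigma> a) = \<beta> a" by auto
    show *: "ext (restr \<beta>) = \<beta>" by (rule ext_restr[OF \<beta> inv])
    have "\<beta> \<in> {..<N} \<rightarrow>\<^sub>E {..<n}" and cards: "\<forall>b<n. card {a. a < N \<and> \<beta> a = b} = bl ! b"
      using \<beta> by (simp_all add: block_colourings_def N n_def)
    then have "restr \<beta> \<in> P \<rightarrow>\<^sub>E {..<n}"
      using ptN by (auto simp: restr_def PiE_iff)
    moreover have "\<forall>b<n. (\<Sum>c | c \<in> P \<and> restr \<beta> c = b. card c) = bl ! b"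
      using cards unfolding card[symmetric] * .
    ultimately show "restr \<beta> \<in> {\<gamma>. \<gamma> \<in> P \<rightarrow>\<^sub>E {..<n} \<and> (\<forall>b<n. (\<Sum>c | c \<in> P \<and> \<gamma> c = b. card c) = bl ! b)}"
      by blast
  next
    fix \<gamma> assume "\<gamma> \<in> {\<gamma>. \<gamma> \<in> P \<rightarrow>\<^sub>E {..<n} \<and> (\<forall>b<n. (\<Sum>c | c \<in> P \<and> \<gamma> c = b. card c) = bl ! b)}"
    then have \<gamma>: "\<gamma> \<in> P \<rightarrow>\<^sub>E {..<n}" and sums: "\<forall>b<n. (\<Sum>c | c \<in> P \<and> \<gamma> c = b. card c) = bl ! b"
      by blast+
    show "restr (ext \<gamma>) = \<gamma>" by (rule restr_ext[OF \<gamma>])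
    have "ext \<gamma> \<in> {..<N} \<rightarrow>\<^sub>E {..<n}"
      using \<gamma> orbP by (auto simp: ext_def PiE_iff)
    moreover have "\<forall>b<n. card {a. a < N \<and> ext \<gamma> a = b} = bl ! b"
      using sums by (simp only: card)
    ultimately have "ext \<gamma> \<in> block_colourings bl"
      unfolding block_colourings_def N[symmetric] n_def[symmetric] by blast
    moreover have "\<forall>a<N. ext \<gamma> (\<sigma> a) = ext \<gamma> a"
      using permutes_lessThan[OF \<sigma>] by (simp add: ext_def permutation_orbit_step[OF perm])
    ultimately show "ext \<gamma> \<in> {\<beta>. \<beta> \<in> block_colourings bl \<and> (\<forall>a<N. \<beta> (\<sigma> a) = \<beta> a)}"
      by blast
  qed simp
  then show ?thesis unfolding P_def restr_def n_def .
qed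

lemma conjugacy_classesD:
  assumes G: "group G" and K: "K \<in> conjugacy_classes G"
  shows "K \<subseteq> carrier G" and "K \<noteq> {}"
    and "g \<in> K \<Longrightarrow> K = {h \<otimes>\<^bsub>G\<^esub> g \<otimes>\<^bsub>G\<^esub> inv\<^bsub>G\<^esub> h | h. h \<in> carrier G}"
proof -
  interpret group G by fact
  define cl where "cl x = {h \<otimes>\<^bsub>G\<^esub> x \<otimes>\<^bsub>G\<^esub> inv\<^bsub>G\<^esub> h | h. h \<in> carrier G}" for x
  obtain x where x: "x \<in> carrier G" and "K = Group_Action.orbit G (\<lambda>g. \<lambda>h\<in>carrier G. g \<otimes>\<^bsub>G\<^esub> h \<otimes>\<^bsub>G\<^esub> inv\<^bsub>G\<^esub> g) x"
    using K unfolding conjugacy_classes_def Group_Action.orbits_def by blast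
  then have Kx: "K = cl x"
    unfolding Group_Action.orbit_def cl_def by simp
  have sub: "cl x \<subseteq> carrier G" if "x \<in> carrier G" for x
    using that unfolding cl_def by auto
  show "K \<subseteq> carrier G" unfolding Kx by (rule sub[OF x])
  have "\<one>\<^bsub>G\<^esub> \<otimes>\<^bsub>G\<^esub> x \<otimes>\<^bsub>G\<^esub> inv\<^bsub>G\<^esub> \<one>\<^bsub>G\<^esub> \<in> cl x" unfolding cl_def using one_closed by blast
  then show "K \<noteq> {}" unfolding Kx by blast
  have conj_cl: "cl (h \<otimes>\<^bsub>G\<^esub> y \<otimes>\<^bsub>G\<^esub> inv\<^bsub>G\<^esub> h) \<subseteq> cl y" if "h \<in> carrier G" "y \<in> carrier G" for h y
  proof
    fix z assume "z \<in> cl (h \<otimes>\<^bsub>G\<^esub> y \<otimes>\<^bsub>G\<^esub> inv\<^bsub>G\<^esub> h)"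
    then obtain k where k: "k \<in> carrier G" "z = k \<otimes>\<^bsub>G\<^esub> (h \<otimes>\<^bsub>G\<^esub> y \<otimes>\<^bsub>G\<^esub> inv\<^bsub>G\<^esub> h) \<otimes>\<^bsub>G\<^esub> inv\<^bsub>G\<^esub> k"
      unfolding cl_def by blast
    have "z = (k \<otimes>\<^bsub>G\<^esub> h) \<otimes>\<^bsub>G\<^esub> y \<otimes>\<^bsub>G\<^esub> inv\<^bsub>G\<^esub> (k \<otimes>\<^bsub>G\<^esub> h)"
      using k that by (simp add: m_assoc inv_mult_group)
    then show "z \<in> cl y" unfolding cl_def using k(1) that(1) m_closed by blast
  qed
  show "K = {h \<otimes>\<^bsub>G\<^esub> g \<otimes>\<^bsub>G\<^esub> inv\<^bsub>G\<^esub> h | h. h \<in> carrier G}" if g: "g \<in> K"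
  proof -
    obtain k where k: "k \<in> carrier G" "g = k \<otimes>\<^bsub>G\<^esub> x \<otimes>\<^bsub>G\<^esub> inv\<^bsub>G\<^esub> k"
      using g unfolding Kx cl_def by blast
    have gG: "g \<in> carrier G" using g sub[OF x] unfolding Kx by blast
    have "x = inv\<^bsub>G\<^esub> k \<otimes>\<^bsub>G\<^esub> g \<otimes>\<^bsub>G\<^esub> inv\<^bsub>G\<^esub> (inv\<^bsub>G\<^esub> k)"
    proof -
      have "inv\<^bsub>G\<^esub> k \<otimes>\<^bsub>G\<^esub> (k \<otimes>\<^bsub>G\<^esub> x) = x" using k(1) x by (simp flip: m_assoc)
      then show ?thesis using k x by (simp add: m_assoc)
    qed
    then have "cl x \<subseteq> cl g" using conj_cl[OF inv_closed[OF k(1)] gG] by simp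
    moreover have "cl g \<subseteq> cl x" unfolding k(2) by (rule conj_cl[OF k(1) x])
    ultimately show ?thesis unfolding Kx cl_def[symmetric] by (rule equalityI)
  qed
qed

lemma in_conjugacy_class:
  assumes "group G" and "g \<in> carrier G"
  shows "\<exists>K\<in>conjugacy_classes G. g \<in> K"
proof -
  interpret group G by fact
  let ?\<phi> = "\<lambda>g. \<lambda>h\<in>carrier G. g \<otimes>\<^bsub>G\<^esub> h \<otimes>\<^bsub>G\<^esub> inv\<^bsub>G\<^esub> g"
  have "?\<phi> \<one>\<^bsub>G\<^esub> g = g" using assms(2) by simp
  then have "g \<in> Group_Action.orbit G ?\<phi> g"
    unfolding Group_Action.orbit_def by (intro CollectI exI[of _ "\<one>\<^bsub>G\<^esub>"]) simp
  then show ?thesis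
    unfolding conjugacy_classes_def Group_Action.orbits_def using assms(2) by blast
qed

text \<open>
  Moving the starting point by one rotates the cyclic product, which conjugates it by the factor that
  changes sides.
\<close>

lemma cycle_product_step:
  assumes G: "group G" and \<sigma>: "\<sigma> permutes {..<N}" and a: "a < N" and f: "\<And>a. a < N \<Longrightarrow> f a \<in> carrier G"
  shows "cycle_product G (f, \<sigma>) a =
    f a \<otimes>\<^bsub>G\<^esub> cycle_product G (f, \<sigma>) (inv_into UNIV \<sigma> a) \<otimes>\<^bsub>G\<^esub> inv\<^bsub>G\<^esub> f a"
proof -
  interpret group G by fact
  define s where "s = inv_into UNIV \<sigma>"
  have s: "s permutes {..<N}" unfolding s_def using \<sigma> by (rule permutes_inv)
  have perm: "permutation \<sigma>" using \<sigma> by (auto simp: permutation_permutes)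
  have perm_s: "permutation s" using s by (auto simp: permutation_permutes)
  have orb_s: "Orbits.orbit s b = Orbits.orbit \<sigma> b" for b
    unfolding s_def by (rule orbit_inv_eq[OF perm])
  have sN: "(s ^^ r) a < N" for r
    using permutes_lessThan[OF s] a by (induction r) auto
  obtain l where l: "card (Orbits.orbit \<sigma> a) = Suc l"
    using funpow_bij_betw_orbit(3)[OF perm, of a] by (metis Suc_pred)
  have l': "card (Orbits.orbit \<sigma> (s a)) = Suc l"
    using permutation_orbit_step[OF perm_s, of a] l by (simp add: orb_s)
  have s_l: "(s ^^ Suc l) a = a"
    using funpow_bij_betw_orbit(2)[OF perm_s, of a] by (simp only: orb_s l)
  define X where "X = foldr (\<lambda>r y. f ((s ^^ Suc r) a) \<otimes>\<^bsub>G\<^esub> y) [0..<l] \<one>\<^bsub>G\<^esub>"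
  have X: "X \<in> carrier G"
    unfolding X_def by (rule foldr_mult_closed[OF G]) (rule f[OF sN])
  have upt: "[0..<Suc l] = 0 # map Suc [0..<l]"
    by (simp add: upt_conv_Cons map_Suc_upt del: upt_Suc)
  have snoc: "foldr (\<lambda>r y. u r \<otimes>\<^bsub>G\<^esub> y) xs z = foldr (\<lambda>r y. u r \<otimes>\<^bsub>G\<^esub> y) xs \<one>\<^bsub>G\<^esub> \<otimes>\<^bsub>G\<^esub> z"
    if "\<And>r. u r \<in> carrier G" "z \<in> carrier G" for u z and xs :: "nat list"
    using that by (induction xs) (simp_all add: m_assoc foldr_mult_closed[OF G])
  have 1: "cycle_product G (f, \<sigma>) a = f a \<otimes>\<^bsub>G\<^esub> X"
    unfolding cycle_product_def prod.case l upt X_def s_def[symmetric] by (simp add: foldr_map comp_def)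
  have "cycle_product G (f, \<sigma>) (s a) = foldr (\<lambda>r y. f ((s ^^ Suc r) a) \<otimes>\<^bsub>G\<^esub> y) [0..<Suc l] \<one>\<^bsub>G\<^esub>"
    unfolding cycle_product_def prod.case l' s_def[symmetric] by (simp only: funpow_Suc_right comp_apply)
  also have "\<dots> = foldr (\<lambda>r y. f ((s ^^ Suc r) a) \<otimes>\<^bsub>G\<^esub> y) [0..<l] (f a)"
    using s_l f[OF a] by simp
  also have "\<dots> = X \<otimes>\<^bsub>G\<^esub> f a"
    unfolding X_def by (rule snoc) (rule f[OF sN], rule f[OF a])
  finally have 2: "cycle_product G (f, \<sigma>) (s a) = X \<otimes>\<^bsub>G\<^esub> f a" .
  show ?thesis
    unfolding 1 s_def[symmetric] 2 using X f[OF a] by (simp add: m_assoc)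
qed

lemma cycle_product_in_class_iff:
  assumes G: "group G" and \<sigma>: "\<sigma> permutes {..<N}" and a: "a < N" and f: "\<And>a. a < N \<Longrightarrow> f a \<in> carrier G"
    and K: "K \<in> conjugacy_classes G" and b: "b \<in> Orbits.orbit \<sigma> a"
  shows "cycle_product G (f, \<sigma>) b \<in> K \<longleftrightarrow> cycle_product G (f, \<sigma>) a \<in> K"
proof -
  interpret group G by fact
  have conj_step: "cycle_product G (f, \<sigma>) (\<sigma> b) \<in> K \<longleftrightarrow> cycle_product G (f, \<sigma>) b \<in> K" if b: "b < N" for b
  proof -
    define u where "u = cycle_product G (f, \<sigma>) b"
    define v where "v = cycle_product G (f, \<sigma>) (\<sigma> b)"
    define h where "h = f (\<sigma> b)"
    have \<sigma>b: "\<sigma> b < N" by (rule permutes_lessThan[OF \<sigma> b])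
    have h: "h \<in> carrier G" unfolding h_def by (rule f[OF \<sigma>b])
    have u: "u \<in> carrier G" unfolding u_def by (rule cycle_product_closed[OF G \<sigma> b f])
    have vu: "v = h \<otimes>\<^bsub>G\<^esub> u \<otimes>\<^bsub>G\<^esub> inv\<^bsub>G\<^esub> h"
      using cycle_product_step[OF G \<sigma> \<sigma>b f] unfolding u_def v_def h_def permutes_inverses(2)[OF \<sigma>] .
    have uv: "u = inv\<^bsub>G\<^esub> h \<otimes>\<^bsub>G\<^esub> v \<otimes>\<^bsub>G\<^esub> inv\<^bsub>G\<^esub> (inv\<^bsub>G\<^esub> h)"
    proof -
      have "inv\<^bsub>G\<^esub> h \<otimes>\<^bsub>G\<^esub> (h \<otimes>\<^bsub>G\<^esub> u) = u" using h u by (simp flip: m_assoc)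
      then show ?thesis unfolding vu using h u by (simp add: m_assoc)
    qed
    have "v \<in> K" if "u \<in> K"
      using conjugacy_classesD(3)[OF G K that] vu h by blast
    moreover have "u \<in> K" if "v \<in> K"
      using conjugacy_classesD(3)[OF G K that] uv h inv_closed by blast
    ultimately show ?thesis unfolding u_def v_def by blast
  qed
  from b show ?thesis
  proof induction
    case base
    show ?case by (rule conj_step[OF a])
  next
    case (step b)
    have "b < N" using permutes_orbit_subset[OF \<sigma>, of a] a step.hyps by auto
    then show ?case using conj_step[of b] step.IH by simp
  qed
qed


lemma class_index_exists:
  assumes "group G" and "bij_betw C {..<k} (conjugacy_classes G)" and "g \<in> carrier G"
  shows "\<exists>i<k. g \<in> C i"
  using in_conjugacy_class[OF assms(1,3)] bij_betw_imp_surj_on[OF assms(2)] by auto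

lemma class_index_unique:
  assumes G: "group G" and C: "bij_betw C {..<k} (conjugacy_classes G)"
    and "i < k" "j < k" "g \<in> C i" "g \<in> C j"
  shows "i = j"
proof -
  have "C i \<in> conjugacy_classes G" "C j \<in> conjugacy_classes G"
    using assms(3,4) bij_betwE[OF C] by auto
  then have "C i = C j"
    using conjugacy_classesD(3)[OF G _ assms(5)] conjugacy_classesD(3)[OF G _ assms(6)] by simp
  then show ?thesis
    using bij_betw_imp_inj_on[OF C] assms(3,4) by (simp add: inj_on_eq_iff)
qed

lemma cycle_type_nth:
  assumes G: "group G" and C: "bij_betw C {..<k} (conjugacy_classes G)"
    and x: "(f, \<sigma>) \<in> carrier (wreath G N)" and i: "i < k"
    and pt: "\<And>c. c \<in> Orbits.orbit \<sigma> ` {..<N} \<Longrightarrow> pt c \<in> c"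
  shows "cycle_type G N k C (f, \<sigma>) ! i =
    image_mset card (mset_set {c \<in> Orbits.orbit \<sigma> ` {..<N}. cycle_product G (f, \<sigma>) (pt c) \<in> C i})"
proof -
  have \<sigma>: "\<sigma> permutes {..<N}" and f: "\<And>a. a < N \<Longrightarrow> f a \<in> carrier G"
    using x by (auto simp: wreath_simps)
  have Ci: "C i \<in> conjugacy_classes G" using i bij_betwE[OF C] by auto
  have "(\<exists>a\<in>c. cycle_product G (f, \<sigma>) a \<in> C i) \<longleftrightarrow> cycle_product G (f, \<sigma>) (pt c) \<in> C i"
    if c: "c \<in> Orbits.orbit \<sigma> ` {..<N}" for c
  proof -
    have ptN: "pt c < N" using pt[OF c] permutes_orbits(1)[OF \<sigma>] c by blast
    have "c = Orbits.orbit \<sigma> (pt c)" by (rule permutes_orbits(3)[OF \<sigma> c pt[OF c]])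
    then have "cycle_product G (f, \<sigma>) a \<in> C i \<longleftrightarrow> cycle_product G (f, \<sigma>) (pt c) \<in> C i" if "a \<in> c" for a
      using cycle_product_in_class_iff[OF G \<sigma> ptN f Ci, where b = a] that by simp
    then show ?thesis using pt[OF c] by blast
  qed
  then have "{c \<in> Orbits.orbit \<sigma> ` {..<N}. \<exists>a\<in>c. cycle_product G (f, \<sigma>) a \<in> C i} =
      {c \<in> Orbits.orbit \<sigma> ` {..<N}. cycle_product G (f, \<sigma>) (pt c) \<in> C i}"
    by blast
  then show ?thesis using i by (simp add: cycle_type_def)
qed

text \<open>
  Grouping the cycles by the class of their cycle product turns a product over the cycles of an element into
  a product over the parts of its cycle type.
\<close>

lemma prod_cycles_eq_class_polynomial:
  assumes G: "group G" and C: "bij_betw C {..<k} (conjugacy_classes G)"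
    and x: "(f, \<sigma>) \<in> carrier (wreath G N)" and \<mu>: "cycle_type G N k C (f, \<sigma>) = \<mu>"
    and pt: "\<And>c. c \<in> Orbits.orbit \<sigma> ` {..<N} \<Longrightarrow> pt c \<in> c"
    and cls: "\<And>c. c \<in> Orbits.orbit \<sigma> ` {..<N} \<Longrightarrow> cls c < k \<and> cycle_product G (f, \<sigma>) (pt c) \<in> C (cls c)"
  shows "(\<Prod>c\<in>Orbits.orbit \<sigma> ` {..<N}. weighted_power_sum n (w (cls c)) (card c)) = class_polynomial n w \<mu>"
proof -
  define P where "P = Orbits.orbit \<sigma> ` {..<N}"
  have finP: "finite P" by (simp add: P_def)
  have len: "length \<mu> = k" using \<mu> by (auto simp: cycle_type_def)
  have part: "(\<Prod>r\<in>#\<mu> ! i. weighted_power_sum n (w i) r) =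
      (\<Prod>c\<in>{c \<in> P. cls c = i}. weighted_power_sum n (w (cls c)) (card c))" if i: "i < k" for i
  proof -
    have "{c \<in> P. cycle_product G (f, \<sigma>) (pt c) \<in> C i} = {c \<in> P. cls c = i}"
      using cls class_index_unique[OF G C _ i] unfolding P_def by blast
    then have "\<mu> ! i = image_mset card (mset_set {c \<in> P. cls c = i})"
      using cycle_type_nth[OF G C x i pt] unfolding \<mu> P_def[symmetric] by simp
    then have "(\<Prod>r\<in>#\<mu> ! i. weighted_power_sum n (w i) r) =
        (\<Prod>c\<in>{c \<in> P. cls c = i}. weighted_power_sum n (w i) (card c))"
      by (simp add: image_mset.compositionality comp_def prod_unfold_prod_mset)
    also have "\<dots> = (\<Prod>c\<in>{c \<in> P. cls c = i}. weighted_power_sum n (w (cls c)) (card c))"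
      by (intro prod.cong) auto
    finally show ?thesis .
  qed
  have "class_polynomial n w \<mu> = (\<Prod>i<k. \<Prod>c\<in>{c \<in> P. cls c = i}. weighted_power_sum n (w (cls c)) (card c))"
    unfolding class_polynomial_def len by (intro prod.cong refl part) simp
  also have "\<dots> = (\<Prod>c\<in>P. weighted_power_sum n (w (cls c)) (card c))"
    by (rule prod.group[OF finP]) (use cls in \<open>auto simp: P_def\<close>)
  finally show ?thesis unfolding P_def ..
qed

section \<open>Every multipartition is a cycle type\<close>

text \<open>
  The new element acts on the additional positions \<open>M, \<dots>, M + l - 1\<close> by a cyclic shift; all entries of
  the new cycle are \<open>1\<close> except one, which is an element of the wanted class and so is the cycle product.
\<close>

lemma wreath_add_cycle:
  assumes G: "group G" and C: "bij_betw C {..<k} (conjugacy_classes G)"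
    and x: "(f, \<sigma>) \<in> carrier (wreath G M)" and j: "j < k" and l: "0 < l"
  obtains y where "y \<in> carrier (wreath G (M + l))"
    and "cycle_type G (M + l) k C y = (cycle_type G M k C (f, \<sigma>))[j := add_mset l (cycle_type G M k C (f, \<sigma>) ! j)]"
proof -
  interpret group G by fact
  have Cj: "C j \<in> conjugacy_classes G" using j bij_betwE[OF C] by auto
  obtain g where gC: "g \<in> C j" using conjugacy_classesD(2)[OF G Cj] by blast
  have g: "g \<in> carrier G" using conjugacy_classesD(1)[OF G Cj] gC by blast
  have \<sigma>: "\<sigma> permutes {..<M}" and f: "\<And>a. a < M \<Longrightarrow> f a \<in> carrier G"
    using x by (auto simp: wreath_simps)
  have perm: "permutation \<sigma>" using \<sigma> by (auto simp: permutation_permutes)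
  define \<rho> where "\<rho> a = (if a < M then \<sigma> a else if Suc a = M + l then M else if a < M + l then Suc a else a)" for a
  define h where "h a = (if a < M then f a else if a = M then g else if a < M + l then \<one>\<^bsub>G\<^esub> else undefined)" for a
  have \<rho>\<sigma>: "\<rho> a = \<sigma> a" if "a < M" for a using that by (simp add: \<rho>_def)
  have \<rho>_shift: "\<rho> (M + r) = M + Suc r" if "Suc r < l" for r using that by (simp add: \<rho>_def)
  have \<rho>_last: "\<rho> (M + (l - 1)) = M" using l by (cases l) (simp_all add: \<rho>_def)
  have bij: "bij_betw \<rho> {..<M + l} {..<M + l}"
  proof -
    have surj: "\<rho> ` {..<M + l} = {..<M + l}"
    proof
      show "\<rho> ` {..<M + l} \<subseteq> {..<M + l}"
        using permutes_lessThan[OF \<sigma>] l by (fastforce simp: \<rho>_def)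
      show "{..<M + l} \<subseteq> \<rho> ` {..<M + l}"
      proof
        fix a assume "a \<in> {..<M + l}"
        then consider "a < M" | "a = M" | r where "a = M + Suc r" "Suc r < l"
          using less_imp_Suc_add[of M a] by (cases "a < M"; cases "a = M") (auto simp: not_less_iff_gr_or_eq)
        then show "a \<in> \<rho> ` {..<M + l}"
        proof cases
          case 1
          then have "inv_into UNIV \<sigma> a < M" by (rule permutes_inv_lessThan[OF \<sigma>])
          moreover have "\<rho> (inv_into UNIV \<sigma> a) = a"
            using calculation permutes_inverses(1)[OF \<sigma>] by (simp add: \<rho>\<sigma>)
          ultimately show ?thesis by (intro image_eqI[of _ _ "inv_into UNIV \<sigma> a"]) auto
        next
          case 2
          then show ?thesis using \<rho>_last l by (intro image_eqI[of _ _ "M + (l - 1)"]) auto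
        next
          case 3
          then show ?thesis using \<rho>_shift[of r] by (intro image_eqI[of _ _ "M + r"]) auto
        qed
      qed
    qed
    then have "inj_on \<rho> {..<M + l}" by (intro eq_card_imp_inj_on) auto
    with surj show ?thesis by (simp add: bij_betw_def)
  qed
  have \<rho>: "\<rho> permutes {..<M + l}"
    by (rule bij_imp_permutes[OF bij]) (simp add: \<rho>_def)
  have perm\<rho>: "permutation \<rho>" using \<rho> by (auto simp: permutation_permutes)
  have h_closed: "h a \<in> carrier G" if "a < M + l" for a
    using that f g by (simp add: h_def)
  have y: "(h, \<rho>) \<in> carrier (wreath G (M + l))"
    using \<rho> h_closed l unfolding wreath_simps(1) by (auto simp: PiE_iff extensional_def h_def)
  have old_orbit: "Orbits.orbit \<rho> a = Orbits.orbit \<sigma> a" if "a < M" for a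
    using that permutes_lessThan[OF \<sigma>] by (intro orbit_cong0[of a "{..<M}"]) (auto simp: \<rho>\<sigma>)
  have pow: "(\<rho> ^^ r) M = M + r" if "r < l" for r
    using that by (induction r) (simp_all add: \<rho>_shift)
  have "(\<rho> ^^ l) M = \<rho> ((\<rho> ^^ (l - 1)) M)"
    using l by (cases l) simp_all
  also have "(\<rho> ^^ (l - 1)) M = M + (l - 1)"
    using l by (intro pow) simp
  also note \<rho>_last
  finally have "Orbits.orbit \<rho> M = {(\<rho> ^^ r) M | r. r < l}"
    by (rule orbit_altdef_bounded) (rule l)
  also have "\<dots> = {M + r | r. r < l}"
    using pow by force
  also have "\<dots> = {M..<M + l}"
    by (auto simp: le_iff_add)
  finally have new_orbit_M: "Orbits.orbit \<rho> M = {M..<M + l}" .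
  have orbits: "Orbits.orbit \<rho> ` {..<M + l} = insert {M..<M + l} (Orbits.orbit \<sigma> ` {..<M})"
  proof -
    have "{..<M + l} = {..<M} \<union> {M..<M + l}" by auto
    moreover have "Orbits.orbit \<rho> ` {..<M} = Orbits.orbit \<sigma> ` {..<M}"
      by (intro image_cong refl old_orbit) simp
    moreover have "Orbits.orbit \<rho> ` {M..<M + l} = {{M..<M + l}}"
    proof -
      have "Orbits.orbit \<rho> a = {M..<M + l}" if "a \<in> {M..<M + l}" for a
        using orbit_cyclic_eq3[OF cyclic_on_orbit'[OF perm\<rho>, of M], of a] that unfolding new_orbit_M .
      moreover have "M \<in> {M..<M + l}" using l by simp
      ultimately show ?thesis by blast
    qed
    ultimately show ?thesis by (simp add: image_Un)
  qed
  have inv_old: "inv_into UNIV \<rho> a = inv_into UNIV \<sigma> a" if "a < M" for a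
  proof -
    have "\<rho> (inv_into UNIV \<sigma> a) = a"
      using permutes_inv_lessThan[OF \<sigma> that] permutes_inverses(1)[OF \<sigma>] by (simp add: \<rho>\<sigma>)
    then show ?thesis using permutes_inverses(2)[OF \<rho>] by metis
  qed
  have pow_old: "(inv_into UNIV \<rho> ^^ r) a = (inv_into UNIV \<sigma> ^^ r) a \<and> (inv_into UNIV \<sigma> ^^ r) a < M" if "a < M" for r a
    using that permutes_inv_lessThan[OF \<sigma>] by (induction r) (simp_all add: inv_old)
  have cp_old: "cycle_product G (h, \<rho>) a = cycle_product G (f, \<sigma>) a" if a: "a < M" for a
  proof -
    have "h ((inv_into UNIV \<rho> ^^ r) a) = f ((inv_into UNIV \<sigma> ^^ r) a)" for r
      using pow_old[OF a, of r] by (simp add: h_def)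
    then show ?thesis unfolding cycle_product_def prod.case old_orbit[OF a] by simp
  qed
  have cp_new: "cycle_product G (h, \<rho>) M = g"
  proof -
    define s where "s = inv_into UNIV \<rho>"
    have perm_s: "permutation s" unfolding s_def by (rule permutation_inverse[OF perm\<rho>])
    have orb_s: "Orbits.orbit s M = {M..<M + l}"
      unfolding s_def orbit_inv_eq[OF perm\<rho>] by (rule new_orbit_M)
    have bij_s: "bij_betw (\<lambda>r. (s ^^ r) M) {..<l} {M..<M + l}"
      using funpow_bij_betw_orbit(1)[OF perm_s, of M] unfolding orb_s by simp
    \<comment> \<open>The first factor of the cycle product is \<open>g\<close>; the cycle does not return to \<open>M\<close> before its end, so all others are \<open>1\<close>.\<close>
    have one: "h ((s ^^ r) M) = \<one>\<^bsub>G\<^esub>" if "0 < r" "r < l" for r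
    proof -
      have "(s ^^ r) M \<in> {M..<M + l}" using bij_betwE[OF bij_s] that by blast
      moreover have "(s ^^ r) M \<noteq> (s ^^ 0) M"
        using bij_betw_imp_inj_on[OF bij_s] that inj_onD[of "\<lambda>r. (s ^^ r) M" "{..<l}" r 0] by auto
      ultimately show ?thesis by (simp add: h_def)
    qed
    obtain l' where l': "l = Suc l'" using l by (cases l) auto
    have ones: "foldr (\<lambda>r y. h ((s ^^ r) M) \<otimes>\<^bsub>G\<^esub> y) rs \<one>\<^bsub>G\<^esub> = \<one>\<^bsub>G\<^esub>" if "set rs \<subseteq> {0<..<l}" for rs
      using that by (induction rs) (simp_all add: one)
    have "[0..<l] = 0 # [1..<l]" using l by (simp add: upt_conv_Cons)
    then have "cycle_product G (h, \<rho>) M = h M \<otimes>\<^bsub>G\<^esub> foldr (\<lambda>r y. h ((s ^^ r) M) \<otimes>\<^bsub>G\<^esub> y) [1..<l] \<one>\<^bsub>G\<^esub>"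
      unfolding cycle_product_def prod.case new_orbit_M s_def[symmetric] by simp
    also have "\<dots> = g" using g by (subst ones) (auto simp: h_def)
    finally show ?thesis .
  qed
  define pt where "pt c = (SOME a. a \<in> c)" for c :: "nat set"
  define pt' where "pt' c = (if c = {M..<M + l} then M else pt c)" for c
  have pt: "pt c \<in> c" if "c \<in> Orbits.orbit \<sigma> ` {..<M}" for c
    using that orbit_nonempty[of \<sigma>] by (auto simp: pt_def some_in_eq)
  have ptM: "pt c < M" if "c \<in> Orbits.orbit \<sigma> ` {..<M}" for c
    using pt[OF that] permutes_orbits(1)[OF \<sigma>] that by blast
  have new: "c \<noteq> {M..<M + l}" if "c \<in> Orbits.orbit \<sigma> ` {..<M}" for c
    using pt[OF that] ptM[OF that] by auto
  have pt': "pt' c \<in> c" if "c \<in> Orbits.orbit \<rho> ` {..<M + l}" for c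
    using that pt new l unfolding orbits pt'_def by auto
  have "cycle_type G (M + l) k C (h, \<rho>) ! i =
      (cycle_type G M k C (f, \<sigma>))[j := add_mset l (cycle_type G M k C (f, \<sigma>) ! j)] ! i" if i: "i < k" for i
  proof -
    define Q where "Q = {c \<in> Orbits.orbit \<sigma> ` {..<M}. cycle_product G (f, \<sigma>) (pt c) \<in> C i}"
    have Q: "finite Q" "{M..<M + l} \<notin> Q" using new by (auto simp: Q_def)
    have "{c \<in> Orbits.orbit \<rho> ` {..<M + l}. cycle_product G (h, \<rho>) (pt' c) \<in> C i} =
        (if g \<in> C i then insert {M..<M + l} Q else Q)"
      unfolding orbits Q_def using new by (auto simp: pt'_def cp_new cp_old[OF ptM])
    moreover have "g \<in> C i \<longleftrightarrow> i = j"
      using class_index_unique[OF G C i j _ gC] gC by blast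
    ultimately have "cycle_type G (M + l) k C (h, \<rho>) ! i =
        (if i = j then add_mset l (image_mset card (mset_set Q)) else image_mset card (mset_set Q))"
      using cycle_type_nth[OF G C y i pt'] Q by simp
    also have "image_mset card (mset_set Q) = cycle_type G M k C (f, \<sigma>) ! i"
      using cycle_type_nth[OF G C x i pt] by (simp add: Q_def)
    finally show ?thesis using i by (simp add: cycle_type_def)
  qed
  then have "cycle_type G (M + l) k C (h, \<rho>) =
      (cycle_type G M k C (f, \<sigma>))[j := add_mset l (cycle_type G M k C (f, \<sigma>) ! j)]"
    by (intro nth_equalityI) (simp_all add: cycle_type_def)
  then show ?thesis using that y by blast
qed

text \<open>
  By induction on \<open>N\<close>, removing a part from \<open>\<mu>\<close> and adding the corresponding cycle to an element for the smaller multipartition.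
\<close>

lemma wreath_class_nonempty:
  assumes G: "group G" and C: "bij_betw C {..<k} (conjugacy_classes G)"
    and "multipartition k N \<mu>"
  shows "wreath_class G N k C \<mu> \<noteq> {}"
  using assms(3)
proof (induction N arbitrary: \<mu> rule: less_induct)
  case (less N)
  have len: "length \<mu> = k" and pos: "\<And>\<kappa>. \<kappa> \<in> set \<mu> \<Longrightarrow> 0 \<notin># \<kappa>" and N: "(\<Sum>\<kappa>\<leftarrow>\<mu>. \<Sum>\<^sub># \<kappa>) = N"
    using less.prems by (auto simp: multipartition_def)
  show ?case
  proof (cases "\<exists>j<k. \<mu> ! j \<noteq> {#}")
    case False
    then have "\<mu> ! i = {#}" if "i < k" for i using that by blast
    then have \<mu>: "\<mu> = map (\<lambda>i. {#}) [0..<k]" using len by (intro nth_equalityI) simp_all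
    then have "N = 0" using N by (simp add: sum_list_0 comp_def)
    have "((\<lambda>_. undefined), id) \<in> wreath_class G 0 k C \<mu>"
      by (simp add: wreath_class_def wreath_simps(1) cycle_type_def \<mu> permutes_id)
    then show ?thesis unfolding \<open>N = 0\<close> by blast
  next
    case True
    then obtain j l where j: "j < k" and l: "l \<in># \<mu> ! j" by auto
    have "0 \<notin># \<mu> ! j" using pos j len by simp
    with l have l0: "0 < l" by (cases l) auto
    define \<mu>' where "\<mu>' = \<mu>[j := \<mu> ! j - {#l#}]"
    have "(\<Sum>\<kappa>\<leftarrow>\<mu>'. \<Sum>\<^sub># \<kappa>) + l = N"
    proof -
      have split: "(\<Sum>\<kappa>\<leftarrow>\<xi>. \<Sum>\<^sub># \<kappa>) = \<Sum>\<^sub># (\<xi> ! j) + (\<Sum>i\<in>{..<k} - {j}. \<Sum>\<^sub># (\<xi> ! i))" if "length \<xi> = k" for \<xi> :: "nat multiset list"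
      proof -
        have "(\<Sum>\<kappa>\<leftarrow>\<xi>. \<Sum>\<^sub># \<kappa>) = (\<Sum>i<k. \<Sum>\<^sub># (\<xi> ! i))"
          using that by (simp add: sum_list_sum_nth atLeast0LessThan)
        also have "\<dots> = \<Sum>\<^sub># (\<xi> ! j) + (\<Sum>i\<in>{..<k} - {j}. \<Sum>\<^sub># (\<xi> ! i))"
          using j by (intro sum.remove) auto
        finally show ?thesis .
      qed
      have "\<Sum>\<^sub># (\<mu> ! j) = l + \<Sum>\<^sub># (\<mu> ! j - {#l#})"
        using arg_cong[OF insert_DiffM[OF l], of sum_mset] by simp
      moreover have "(\<Sum>i\<in>{..<k} - {j}. \<Sum>\<^sub># (\<mu>' ! i)) = (\<Sum>i\<in>{..<k} - {j}. \<Sum>\<^sub># (\<mu> ! i))"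
        by (intro sum.cong refl) (auto simp: \<mu>'_def)
      ultimately show ?thesis
        using N split[OF len] split[of \<mu>'] len j by (simp add: \<mu>'_def)
    qed
    then have N': "N = (N - l) + l" and lN: "l \<le> N" and sum: "(\<Sum>\<kappa>\<leftarrow>\<mu>'. \<Sum>\<^sub># \<kappa>) = N - l"
      by simp_all
    have "multipartition k (N - l) \<mu>'"
      unfolding multipartition_def
    proof (intro conjI ballI)
      fix \<kappa> assume "\<kappa> \<in> set \<mu>'"
      then obtain i where i: "i < k" "\<kappa> = \<mu>' ! i" using len by (auto simp: \<mu>'_def in_set_conv_nth)
      have "0 \<notin># \<mu> ! i" using pos i(1) len by simp
      then show "0 \<notin># \<kappa>"
        unfolding i(2) \<mu>'_def using i(1) len by (cases "i = j") (auto dest: in_diffD)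
    qed (simp_all add: \<mu>'_def len sum[unfolded \<mu>'_def])
    moreover have "N - l < N" using l0 lN by simp
    ultimately have "wreath_class G (N - l) k C \<mu>' \<noteq> {}" by (intro less.IH)
    then obtain f \<sigma> where x: "(f, \<sigma>) \<in> carrier (wreath G (N - l))" and ct: "cycle_type G (N - l) k C (f, \<sigma>) = \<mu>'"
      by (auto simp: wreath_class_def)
    obtain y where y: "y \<in> carrier (wreath G ((N - l) + l))"
      and cy: "cycle_type G ((N - l) + l) k C y = \<mu>'[j := add_mset l (\<mu>' ! j)]"
      by (rule wreath_add_cycle[OF G C x j l0]) (simp only: ct)
    have "\<mu>'[j := add_mset l (\<mu>' ! j)] = \<mu>"
      using j l len by (simp add: \<mu>'_def)
    then have "y \<in> wreath_class G N k C \<mu>"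
      using y cy N' by (simp add: wreath_class_def)
    then show ?thesis by blast
  qed
qed

section \<open>The values of the character\<close>

text \<open>
  Under the integrality hypothesis, the value on a class is the integer read off from any chosen
  representative; the floor of the real part serves to name that integer.
\<close>

lemma character_value_on_class:
  assumes G: "group G" and ict: "integer_valued_character_table G" and \<rho>: "irreducible_rep G n \<rho>"
    and K: "K \<in> conjugacy_classes G" and g: "g \<in> K"
  shows "mat_trace (\<rho> g) = of_int \<lfloor>Re (mat_trace (\<rho> (SOME h. h \<in> K)))\<rfloor>"
proof -
  define h where "h = (SOME h. h \<in> K)"
  have h: "h \<in> K" unfolding h_def using g by (rule someI)
  have rep: "representation G n \<rho>" using \<rho> by (simp add: irreducible_rep_def)
  have hG: "h \<in> carrier G" using h conjugacy_classesD(1)[OF G K] by blast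
  obtain u where u: "u \<in> carrier G" "g = u \<otimes>\<^bsub>G\<^esub> h \<otimes>\<^bsub>G\<^esub> inv\<^bsub>G\<^esub> u"
    using g conjugacy_classesD(3)[OF G K h] by blast
  have "mat_trace (\<rho> g) = mat_trace (\<rho> h)"
    unfolding u(2) by (rule mat_trace_conjugate[OF rep G hG u(1)])
  moreover have "mat_trace (\<rho> h) \<in> \<int>"
    using ict \<rho> hG by (auto simp: integer_valued_character_table_def)
  then obtain z where "mat_trace (\<rho> h) = of_int z" by (rule Ints_cases)
  ultimately show ?thesis unfolding h_def[symmetric] by simp
qed

text \<open>
  Only the polynomial depends on \<open>\<mu>\<close>; the weights and the monomial are determined by \<open>\<Lambda>\<close>, which is what makes
  values for different \<open>\<mu>\<close> comparable.
\<close>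

lemma perm_char_eq_coefficient:
  assumes G: "group G" and fin: "finite (carrier G)" and ict: "integer_valued_character_table G"
    and C: "bij_betw C {..<k} (conjugacy_classes G)" and V: "irrep_enumeration G k d V"
    and \<Lambda>: "multipartition k N \<Lambda>"
  obtains n w m where "\<And>\<mu>. multipartition k N \<mu> \<Longrightarrow>
    perm_char G N k C d V \<Lambda> \<mu> = of_int (Poly_Mapping.lookup (class_polynomial n w \<mu>) m)"
proof -
  define bl where "bl = blocks \<Lambda>"
  define n where "n = length bl"
  have N: "N = sum_list (blocks \<Lambda>)" and len: "length \<Lambda> = k"
    using \<Lambda> by (simp_all add: multipartition_def sum_list_blocks)
  obtain bcol where bcol: "\<And>b. b < n \<Longrightarrow> bcol b < k" and colours: "colours \<Lambda> = map bcol (block_index (blocks \<Lambda>))"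
    using colours_eq_map_block_index[of \<Lambda>] unfolding n_def bl_def len by blast
  have irr: "irreducible_rep G (d (bcol b)) (V (bcol b))" if "b < n" for b
    using V bcol[OF that] by (simp add: irrep_enumeration_def)
  have rep: "representation G (d (bcol b)) (V (bcol b))" if "b < length (blocks \<Lambda>)" for b
    using irr[of b] that by (simp add: irreducible_rep_def n_def bl_def)
  define w where "w i b = \<lfloor>Re (mat_trace (V (bcol b) (SOME h. h \<in> C i)))\<rfloor>" for i b
  have w: "mat_trace (V (bcol b) g) = of_int (w i b)" if "b < n" "i < k" "g \<in> C i" for b i g
    unfolding w_def using that bij_betwE[OF C] by (intro character_value_on_class[OF G ict irr]) auto
  define m where "m = (\<Sum>b<n. Poly_Mapping.single b (bl ! b))"
  have trace: "mat_trace (perm_module G N d V \<Lambda> x) = of_int (Poly_Mapping.lookup (class_polynomial n w \<mu>) m)"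
    if x: "x \<in> wreath_class G N k C \<mu>" for x \<mu>
  proof -
    obtain f \<sigma> where x': "x = (f, \<sigma>)" by (metis surj_pair)
    have xW: "(f, \<sigma>) \<in> carrier (wreath G N)" and ct: "cycle_type G N k C (f, \<sigma>) = \<mu>"
      using x by (simp_all add: wreath_class_def x')
    have \<sigma>: "\<sigma> permutes {..<N}" and f: "\<And>a. a < N \<Longrightarrow> f a \<in> carrier G"
      using xW by (auto simp: wreath_simps)
    define P where "P = Orbits.orbit \<sigma> ` {..<N}"
    define pt where "pt c = (SOME a. a \<in> c)" for c :: "nat set"
    have pt: "pt c \<in> c" if "c \<in> Orbits.orbit \<sigma> ` {..<N}" for c
      using that orbit_nonempty[of \<sigma>] by (auto simp: pt_def some_in_eq)
    have ptN: "pt c < N" if "c \<in> P" for c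
      using pt permutes_orbits(1)[OF \<sigma>] that unfolding P_def by blast
    define cls where "cls c = (SOME i. i < k \<and> cycle_product G (f, \<sigma>) (pt c) \<in> C i)" for c
    have cls: "cls c < k \<and> cycle_product G (f, \<sigma>) (pt c) \<in> C (cls c)" if "c \<in> Orbits.orbit \<sigma> ` {..<N}" for c
      unfolding cls_def
      by (rule someI_ex, rule class_index_exists[OF G C], rule cycle_product_closed[OF G \<sigma>])
        (use ptN that f in \<open>auto simp: P_def\<close>)
    define F where "F \<gamma> = (\<Prod>c\<in>P. w (cls c) (\<gamma> c))" for \<gamma>
    have "mat_trace (perm_module G N d V \<Lambda> (f, \<sigma>)) =
        (\<Sum>\<beta> | \<beta> \<in> block_colourings bl \<and> (\<forall>a<N. \<beta> (\<sigma> a) = \<beta> a).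
          \<Prod>c\<in>P. mat_trace (V (bcol (\<beta> (pt c))) (cycle_product G (f, \<sigma>) (pt c))))"
      unfolding P_def bl_def
      by (rule mat_trace_perm_module[OF G fin N colours]) (simp_all add: rep xW pt)
    also have "\<dots> = (\<Sum>\<beta> | \<beta> \<in> block_colourings bl \<and> (\<forall>a<N. \<beta> (\<sigma> a) = \<beta> a). of_int (F (\<lambda>c\<in>P. \<beta> (pt c))))"
    proof (rule sum.cong[OF refl])
      fix \<beta> assume "\<beta> \<in> {\<beta>. \<beta> \<in> block_colourings bl \<and> (\<forall>a<N. \<beta> (\<sigma> a) = \<beta> a)}"
      then have \<beta>: "\<beta> a < n" if "a < N" for a
        using that by (auto simp: block_colourings_def PiE_iff n_def N bl_def)
      show "(\<Prod>c\<in>P. mat_trace (V (bcol (\<beta> (pt c))) (cycle_product G (f, \<sigma>) (pt c)))) = of_int (F (\<lambda>c\<in>P. \<beta> (pt c)))"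
        unfolding F_def of_int_prod
      proof (rule prod.cong[OF refl])
        fix c assume c: "c \<in> P"
        then show "mat_trace (V (bcol (\<beta> (pt c))) (cycle_product G (f, \<sigma>) (pt c))) =
            of_int (w (cls c) ((\<lambda>c\<in>P. \<beta> (pt c)) c))"
          using w[OF \<beta>[OF ptN[OF c]]] cls[of c] by (simp add: P_def)
      qed
    qed
    also have "\<dots> = of_int (\<Sum>\<beta> | \<beta> \<in> block_colourings bl \<and> (\<forall>a<N. \<beta> (\<sigma> a) = \<beta> a). F (\<lambda>c\<in>P. \<beta> (pt c)))"
      by (rule of_int_sum[symmetric])
    also have "(\<Sum>\<beta> | \<beta> \<in> block_colourings bl \<and> (\<forall>a<N. \<beta> (\<sigma> a) = \<beta> a). F (\<lambda>c\<in>P. \<beta> (pt c))) =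
        (\<Sum>\<gamma> | \<gamma> \<in> P \<rightarrow>\<^sub>E {..<n} \<and> (\<forall>b<n. (\<Sum>c | c \<in> P \<and> \<gamma> c = b. card c) = bl ! b). F \<gamma>)"
      unfolding P_def n_def by (rule sum_invariant_colourings[OF \<sigma> N[folded bl_def] pt])
    also have "\<dots> = Poly_Mapping.lookup (\<Prod>c\<in>P. weighted_power_sum n (w (cls c)) (card c)) m"
      unfolding F_def m_def by (rule lookup_prod_weighted_power_sum[symmetric]) (simp add: P_def)
    also have "(\<Prod>c\<in>P. weighted_power_sum n (w (cls c)) (card c)) = class_polynomial n w \<mu>"
      unfolding P_def by (rule prod_cycles_eq_class_polynomial[OF G C xW ct pt cls])
    finally show ?thesis unfolding x' .
  qed
  show thesis
  proof (rule that)
    fix \<mu> assume \<mu>: "multipartition k N \<mu>"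
    let ?z = "of_int (Poly_Mapping.lookup (class_polynomial n w \<mu>) m) :: complex"
    have "(\<lambda>x. mat_trace (perm_module G N d V \<Lambda> x)) ` wreath_class G N k C \<mu> = {?z}"
      using wreath_class_nonempty[OF G C \<mu>] trace by (auto simp: image_iff)
    then show "perm_char G N k C d V \<Lambda> \<mu> = ?z"
      unfolding perm_char_def by (intro the_equality) auto
  qed
qed

theorem lemma3p2:
  fixes G :: "('g, 'b) monoid_scheme" and p k N :: nat
    and C :: "nat \<Rightarrow> 'g set" and d :: "nat \<Rightarrow> nat" and V :: "nat \<Rightarrow> 'g \<Rightarrow> complex mat"
    and \<mu> \<nu> :: "nat multiset list"
  assumes "prime p"
    and "group G" and "finite (carrier G)"
    and "integer_valued_character_table G"
    and "bij_betw C {..<k} (conjugacy_classes G)"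
    and "irrep_enumeration G k d V"
    and "multipartition k N \<mu>" and "multipartition k N \<nu>"
    and "sim p \<mu> \<nu>"
  shows "\<forall>\<Lambda>. multipartition k N \<Lambda> \<longrightarrow>
    (\<exists>a b :: int. perm_char G N k C d V \<Lambda> \<mu> = of_int a \<and> perm_char G N k C d V \<Lambda> \<nu> = of_int b \<and>
       [a = b] (mod int p))"
proof (intro allI impI)
  fix \<Lambda> assume "multipartition k N \<Lambda>"
  then obtain n w m where char: "\<And>\<kappa>. multipartition k N \<kappa> \<Longrightarrow>
      perm_char G N k C d V \<Lambda> \<kappa> = of_int (Poly_Mapping.lookup (class_polynomial n w \<kappa>) m)"
    using perm_char_eq_coefficient[OF assms(2-6)] by blast
  have "[Poly_Mapping.lookup (class_polynomial n w \<mu>) m = Poly_Mapping.lookup (class_polynomial n w \<nu>) m] (mod int p)"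
    using assms(1,9) by (intro lookup_cong_mod class_polynomial_sim)
  then show "\<exists>a b :: int. perm_char G N k C d V \<Lambda> \<mu> = of_int a \<and> perm_char G N k C d V \<Lambda> \<nu> = of_int b \<and>
      [a = b] (mod int p)"
    using char[OF assms(7)] char[OF assms(8)] by blast
qed

end
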